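(* Let $G_1$, $G_2$ be nontrivial countable discrete groups, let $\Phi$ be an $N$-function in $\Delta_2(0)\cap\nabla_2(0)$, and let $G=G_1\wr G_2$. If $G_1$ is nonamenable, then $H^1(G,\ell^\Phi(G))=0$.
   Context: $G_1\wr G_2$ is the (restricted) wreath product $\bigl(\bigoplus_{G_2}G_1\bigr)\rtimes G_2$, where $G_2$ acts on the direct sum (finitely supported functions $G_2\to G_1$) by translating the index set $G_2$. An $N$-function is a function $\Phi:\mathbb{R}\to\mathbb{R}$ of the form $\Phi(x)=\int_0^{|x|}\varphi(t)\,dt$, where $\varphi:[0,\infty)\to[0,\infty)$ is non-decreasing, right-continuous, $\varphi(0)=0$, $\varphi(t)>0$ for $t>0$, and $\lim_{t\to\infty}\varphi(t)=\infty$. $\Phi\in\Delta_2(0)$ means: there are $x_0>0$ and $K>2$ with $\Phi(2x)\le K\Phi(x)$ for $0\le x\le x_0$. $\Phi\in\nabla_2(0)$ means: there are $x_0>0$ and $c>1$ with $\Phi(x)\le\frac{1}{2c}\Phi(cx)$ for $0\le x\le x_0$. For a countable set $X$ and $f:X\to\mathbb{R}$ put $\rho_\Phi(f)=\sum_{x\in X}\Phi(f(x))$. The Orlicz space is $\ell^\Phi(X)=\{f:X\to\mathbb{R} : \rho_\Phi(af)<\infty \text{ for some } a>0\}$, equipped with the gauge norm $\|f\|_{(\Phi)}=\inf\{k>0 : \rho_\Phi(f/k)\le 1\}$. For a discrete group $G$, $\ell^\Phi(G)$ is a Banach $G$-module under the left regular representation $(\lambda_G(g)f)(x)=f(g^{-1}x)$.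 For a discrete group $G$ and a Banach $G$-module $V$ (a Banach space with a linear isometric representation $\pi$ of $G$): $Z^1(G,V)=\{b:G\to V : b(gh)=b(g)+\pi(g)b(h)\ \forall g,h\in G\}$; $B^1(G,V)$ is the subspace of those $b$ for which there is $v\in V$ with $b(g)=\pi(g)v-v$ for all $g\in G$; $H^1(G,V)=Z^1(G,V)/B^1(G,V)$. *)

theory Defs
  imports "HOL-Analysis.Analysis" "HOL-Algebra.Product_Groups" "HOL-Library.Function_Algebras"
begin

section \<open>Wreath products\<close>

definition semidirect_product ::
    "('n, 'c) monoid_scheme \<Rightarrow> ('h, 'd) monoid_scheme \<Rightarrow> ('h \<Rightarrow> 'n \<Rightarrow> 'n) \<Rightarrow> ('n \<times> 'h) monoid" where
  "semidirect_product N H \<alpha> =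
     \<lparr> carrier = carrier N \<times> carrier H,
       monoid.mult = (\<lambda>(n, h) (n', h'). (n \<otimes>\<^bsub>N\<^esub> \<alpha> h n', h \<otimes>\<^bsub>H\<^esub> h')),
       one = (\<one>\<^bsub>N\<^esub>, \<one>\<^bsub>H\<^esub>) \<rparr>"

definition index_shift :: "('h, 'd) monoid_scheme \<Rightarrow> 'h \<Rightarrow> ('h \<Rightarrow> 'a) \<Rightarrow> 'h \<Rightarrow> 'a" where
  "index_shift H h f = (\<lambda>x\<in>carrier H. f (inv\<^bsub>H\<^esub> h \<otimes>\<^bsub>H\<^esub> x))"

definition wreath_product ::
    "('a, 'c) monoid_scheme \<Rightarrow> ('h, 'd) monoid_scheme \<Rightarrow> (('h \<Rightarrow> 'a) \<times> 'h) monoid" where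
  "wreath_product G H = semidirect_product (sum_group (carrier H) (\<lambda>_. G)) H (index_shift H)"

lemma group_wreath_product:
  assumes "group G" "group H"
  shows "group (wreath_product G H)"
proof -
  interpret G: group G by fact
  interpret H: group H by fact
  let ?N = "sum_group (carrier H) (\<lambda>_. G)"
  interpret N: group ?N by (rule sum_group) (rule assms)
  have N: "carrier ?N = {x \<in> carrier H \<rightarrow>\<^sub>E carrier G. finite {i \<in> carrier H. x i \<noteq> \<one>\<^bsub>G\<^esub>}}"
    by (rule carrier_sum_group) (rule assms)
  have shift: "index_shift H h f \<in> carrier ?N" if h: "h \<in> carrier H" and f: "f \<in> carrier ?N" for h f
  proof -
    have "{i \<in> carrier H. f (inv\<^bsub>H\<^esub> h \<otimes>\<^bsub>H\<^esub> i) \<noteq> \<one>\<^bsub>G\<^esub>}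
        \<subseteq> (\<lambda>i. h \<otimes>\<^bsub>H\<^esub> i) ` {i \<in> carrier H. f i \<noteq> \<one>\<^bsub>G\<^esub>}"
    proof
      fix i assume i: "i \<in> {i \<in> carrier H. f (inv\<^bsub>H\<^esub> h \<otimes>\<^bsub>H\<^esub> i) \<noteq> \<one>\<^bsub>G\<^esub>}"
      have "i = h \<otimes>\<^bsub>H\<^esub> (inv\<^bsub>H\<^esub> h \<otimes>\<^bsub>H\<^esub> i)"
        using i h by (simp add: H.m_assoc [symmetric])
      then show "i \<in> (\<lambda>i. h \<otimes>\<^bsub>H\<^esub> i) ` {i \<in> carrier H. f i \<noteq> \<one>\<^bsub>G\<^esub>}"
        using i h by auto
    qed
    then have "finite {i \<in> carrier H. f (inv\<^bsub>H\<^esub> h \<otimes>\<^bsub>H\<^esub> i) \<noteq> \<one>\<^bsub>G\<^esub>}"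
      using f by (auto simp: N intro: finite_subset)
    then show ?thesis
      using f h by (auto simp: N index_shift_def PiE_iff cong: conj_cong)
  qed
  have shift_mult: "index_shift H h (f \<otimes>\<^bsub>?N\<^esub> g) = index_shift H h f \<otimes>\<^bsub>?N\<^esub> index_shift H h g"
    if "h \<in> carrier H" for h f g
    using that by (auto simp: index_shift_def fun_eq_iff)
  have shift_shift: "index_shift H (h \<otimes>\<^bsub>H\<^esub> k) f = index_shift H h (index_shift H k f)"
    if "h \<in> carrier H" "k \<in> carrier H" for h k f
    using that by (auto simp: index_shift_def fun_eq_iff H.inv_mult_group H.m_assoc)
  have shift_one: "index_shift H \<one>\<^bsub>H\<^esub> f = f" if "f \<in> carrier ?N" for f
    using that by (auto simp: index_shift_def fun_eq_iff N PiE_iff extensional_def)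
  note [simp del] = mult_sum_group one_sum_group inv_sum_group
  show ?thesis
  proof (rule groupI)
    fix x assume x: "x \<in> carrier (wreath_product G H)"
    obtain f h where fh: "x = (f, h)" "f \<in> carrier ?N" "h \<in> carrier H"
      using x by (auto simp: wreath_product_def semidirect_product_def)
    let ?y = "(index_shift H (inv\<^bsub>H\<^esub> h) (inv\<^bsub>?N\<^esub> f), inv\<^bsub>H\<^esub> h)"
    have "index_shift H k \<one>\<^bsub>?N\<^esub> = \<one>\<^bsub>?N\<^esub>" if "k \<in> carrier H" for k
      using that by (auto simp: index_shift_def fun_eq_iff one_sum_group)
    then have "?y \<otimes>\<^bsub>wreath_product G H\<^esub> x = \<one>\<^bsub>wreath_product G H\<^esub>"
      using fh by (simp add: wreath_product_def semidirect_product_def flip: shift_mult)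
    moreover have "?y \<in> carrier (wreath_product G H)"
      using fh by (simp add: wreath_product_def semidirect_product_def shift)
    ultimately show "\<exists>y\<in>carrier (wreath_product G H).
        y \<otimes>\<^bsub>wreath_product G H\<^esub> x = \<one>\<^bsub>wreath_product G H\<^esub>" by blast
  qed (auto simp: wreath_product_def semidirect_product_def shift shift_mult shift_shift shift_one
        N.m_assoc H.m_assoc)
qed

section \<open>The left regular representation and amenability\<close>

text \<open>Real functions on (the carrier of) a group, and more generally on a set \<open>X\<close>, are total
  functions vanishing outside \<open>X\<close>, so that pointwise addition and equality are those
  of the function type.\<close>

definition left_regular :: "('g, 'm) monoid_scheme \<Rightarrow> 'g \<Rightarrow> ('g \<Rightarrow> real) \<Rightarrow> 'g \<Rightarrow> real" where
  "left_regular G g f = (\<lambda>x. if x \<in> carrier G then f (inv\<^bsub>G\<^esub> g \<otimes>\<^bsub>G\<^esub> x) else 0)"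

definition bounded_functions :: "'a set \<Rightarrow> ('a \<Rightarrow> real) set" where
  "bounded_functions X = {f. (\<forall>x. x \<notin> X \<longrightarrow> f x = 0) \<and> bounded (f ` X)}"

text \<open>Amenability of a discrete group: existence of a left-invariant mean on its bounded functions.\<close>

definition amenable :: "('g, 'm) monoid_scheme \<Rightarrow> bool" where
  "amenable G \<longleftrightarrow>
     (\<exists>m :: ('g \<Rightarrow> real) \<Rightarrow> real.
        (\<forall>f \<in> bounded_functions (carrier G). \<forall>f' \<in> bounded_functions (carrier G).
           m (f + f') = m f + m f') \<and>
        (\<forall>c. \<forall>f \<in> bounded_functions (carrier G). m (\<lambda>x. c * f x) = c * m f) \<and>
        (\<forall>f \<in> bounded_functions (carrier G). (\<forall>x. 0 \<le> f x) \<longrightarrow> 0 \<le> m f) \<and>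
        m (indicator (carrier G)) = 1 \<and>
        (\<forall>g \<in> carrier G. \<forall>f \<in> bounded_functions (carrier G). m (left_regular G g f) = m f))"

section \<open>Orlicz spaces\<close>

definition N_function :: "(real \<Rightarrow> real) \<Rightarrow> bool" where
  "N_function \<Phi> \<longleftrightarrow>
     (\<exists>\<phi> :: real \<Rightarrow> real.
        mono_on {0..} \<phi> \<and>
        (\<forall>t\<ge>0. continuous (at_right t) \<phi>) \<and>
        \<phi> 0 = 0 \<and>
        (\<forall>t>0. \<phi> t > 0) \<and>
        filterlim \<phi> at_top at_top \<and>
        (\<forall>x. \<Phi> x = integral {0..\<bar>x\<bar>} \<phi>))"

definition Delta2_at_0 :: "(real \<Rightarrow> real) \<Rightarrow> bool" where
  "Delta2_at_0 \<Phi> \<longleftrightarrow> (\<exists>x0>0. \<exists>K>2. \<forall>x. 0 \<le> x \<and> x \<le> x0 \<longrightarrow> \<Phi> (2 * x) \<le> K * \<Phi> x)"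

definition Nabla2_at_0 :: "(real \<Rightarrow> real) \<Rightarrow> bool" where
  "Nabla2_at_0 \<Phi> \<longleftrightarrow>
     (\<exists>x0>0. \<exists>c>1. \<forall>x. 0 \<le> x \<and> x \<le> x0 \<longrightarrow> \<Phi> x \<le> 1 / (2 * c) * \<Phi> (c * x))"

text \<open>The modular takes values in \<open>[0, \<infinity>]\<close>; the coercion \<open>ennreal\<close>, which truncates negative
  numbers to \<open>0\<close>, is harmless because an \<open>N\<close>-function is nonnegative.\<close>

definition orlicz_modular :: "(real \<Rightarrow> real) \<Rightarrow> 'a set \<Rightarrow> ('a \<Rightarrow> real) \<Rightarrow> ennreal" where
  "orlicz_modular \<Phi> X f = (\<Sum>\<^sub>\<infinity>x\<in>X. ennreal (\<Phi> (f x)))"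

definition orlicz_space :: "(real \<Rightarrow> real) \<Rightarrow> 'a set \<Rightarrow> ('a \<Rightarrow> real) set" where
  "orlicz_space \<Phi> X =
     {f. (\<forall>x. x \<notin> X \<longrightarrow> f x = 0) \<and> (\<exists>a>0. orlicz_modular \<Phi> X (\<lambda>x. a * f x) < \<infinity>)}"

definition gauge_norm :: "(real \<Rightarrow> real) \<Rightarrow> 'a set \<Rightarrow> ('a \<Rightarrow> real) \<Rightarrow> real" where
  "gauge_norm \<Phi> X f = Inf {k. k > 0 \<and> orlicz_modular \<Phi> X (\<lambda>x. f x / k) \<le> 1}"

lemma orlicz_modular_left_regular:
  assumes "group G" "g \<in> carrier G"
  shows "orlicz_modular \<Phi> (carrier G) (\<lambda>x. left_regular G g f x * a)
       = orlicz_modular \<Phi> (carrier G) (\<lambda>x. f x * a)"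
proof -
  interpret group G by fact
  have inj: "inj_on (\<lambda>x. inv\<^bsub>G\<^esub> g \<otimes>\<^bsub>G\<^esub> x) (carrier G)"
    using assms(2) by (simp add: inj_on_def)
  have img: "(\<lambda>x. inv\<^bsub>G\<^esub> g \<otimes>\<^bsub>G\<^esub> x) ` carrier G = carrier G"
    using assms(2) by (simp add: surj_const_mult)
  have "orlicz_modular \<Phi> (carrier G) (\<lambda>x. left_regular G g f x * a)
      = (\<Sum>\<^sub>\<infinity>x\<in>carrier G. ((\<lambda>x. ennreal (\<Phi> (f x * a))) \<circ> (\<lambda>x. inv\<^bsub>G\<^esub> g \<otimes>\<^bsub>G\<^esub> x)) x)"
    unfolding orlicz_modular_def by (rule infsum_cong) (simp add: left_regular_def)
  also have "\<dots> = orlicz_modular \<Phi> (carrier G) (\<lambda>x. f x * a)"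
    unfolding orlicz_modular_def
    using infsum_reindex [OF inj, of "\<lambda>x. ennreal (\<Phi> (f x * a))"] img
    by (simp add: comp_def)
  finally show ?thesis .
qed

lemma left_regular_orlicz_space:
  assumes "group G" "g \<in> carrier G" "f \<in> orlicz_space \<Phi> (carrier G)"
  shows "left_regular G g f \<in> orlicz_space \<Phi> (carrier G)"
  using assms orlicz_modular_left_regular [OF assms(1,2)]
  by (auto simp: orlicz_space_def mult.commute) (simp add: left_regular_def)

lemma gauge_norm_left_regular:
  assumes "group G" "g \<in> carrier G"
  shows "gauge_norm \<Phi> (carrier G) (left_regular G g f) = gauge_norm \<Phi> (carrier G) f"
  unfolding gauge_norm_def divide_inverse by (simp add: orlicz_modular_left_regular [OF assms])

lemma N_function_mono:
  assumes "N_function \<Phi>" "\<bar>x\<bar> \<le> \<bar>y\<bar>"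
  shows "0 \<le> \<Phi> x" "\<Phi> x \<le> \<Phi> y"
proof -
  obtain \<phi> :: "real \<Rightarrow> real" where \<phi>: "mono_on {0..} \<phi>" "\<phi> 0 = 0" "\<forall>t>0. \<phi> t > 0"
    and \<Phi>: "\<forall>x. \<Phi> x = integral {0..\<bar>x\<bar>} \<phi>"
    using assms(1) unfolding N_function_def by blast
  have int: "\<phi> integrable_on {0..c}" for c
    by (rule integrable_on_mono_on) (rule mono_on_subset [OF \<phi>(1)], simp)
  have nn: "0 \<le> \<phi> t" if "0 \<le> t" for t
    using \<phi>(2,3) that by (cases "t = 0") (auto intro: less_imp_le)
  show "0 \<le> \<Phi> x"
    using \<Phi> by (auto intro!: integral_nonneg int nn)
  show "\<Phi> x \<le> \<Phi> y"
    using \<Phi> nn assms(2) by (simp add: integral_subset_le int)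
qed

lemma orlicz_space_add:
  assumes "N_function \<Phi>" "f \<in> orlicz_space \<Phi> X" "f' \<in> orlicz_space \<Phi> X"
  shows "f + f' \<in> orlicz_space \<Phi> X"
proof -
  obtain a where a: "a > 0" "orlicz_modular \<Phi> X (\<lambda>x. a * f x) < \<infinity>"
    using assms(2) by (auto simp: orlicz_space_def)
  obtain b where b: "b > 0" "orlicz_modular \<Phi> X (\<lambda>x. b * f' x) < \<infinity>"
    using assms(3) by (auto simp: orlicz_space_def)
  define c where "c = min a b / 2"
  have c: "c > 0" using a b by (simp add: c_def)
  have *: "ennreal (\<Phi> (c * (f x + f' x))) \<le> ennreal (\<Phi> (a * f x)) + ennreal (\<Phi> (b * f' x))" for x
  proof -
    have "c * \<bar>f x\<bar> \<le> (a / 2) * \<bar>f x\<bar>" "c * \<bar>f' x\<bar> \<le> (b / 2) * \<bar>f' x\<bar>"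
      by (auto simp: c_def intro!: mult_right_mono)
    moreover have "c * \<bar>f x + f' x\<bar> \<le> c * \<bar>f x\<bar> + c * \<bar>f' x\<bar>"
      using c by (simp flip: distrib_left)
    ultimately have "\<bar>c * (f x + f' x)\<bar> \<le> \<bar>a * f x\<bar> \<or> \<bar>c * (f x + f' x)\<bar> \<le> \<bar>b * f' x\<bar>"
      using a b c by (auto simp: abs_mult)
    then have "\<Phi> (c * (f x + f' x)) \<le> \<Phi> (a * f x) + \<Phi> (b * f' x)"
      using N_function_mono [OF assms(1)] by (meson add_increasing add_increasing2 order_refl)
    then show ?thesis
      using N_function_mono [OF assms(1) order_refl] by (simp add: ennreal_leI flip: ennreal_plus)
  qed
  have "orlicz_modular \<Phi> X (\<lambda>x. c * (f + f') x)
      \<le> (\<Sum>\<^sub>\<infinity>x\<in>X. ennreal (\<Phi> (a * f x)) + ennreal (\<Phi> (b * f' x)))"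
    unfolding orlicz_modular_def plus_fun_apply
    by (intro infsum_mono nonneg_summable_on_complete * zero_le)
  also have "\<dots> = orlicz_modular \<Phi> X (\<lambda>x. a * f x) + orlicz_modular \<Phi> X (\<lambda>x. b * f' x)"
    unfolding orlicz_modular_def by (intro infsum_add nonneg_summable_on_complete zero_le)
  also have "\<dots> < \<infinity>" using a b by simp
  finally show ?thesis
    using c assms(2,3) unfolding orlicz_space_def by auto
qed

lemma orlicz_space_zero_minus:
  assumes "N_function \<Phi>"
  shows "0 \<in> orlicz_space \<Phi> X"
    and "f \<in> orlicz_space \<Phi> X \<Longrightarrow> - f \<in> orlicz_space \<Phi> X"
proof -
  have "\<Phi> 0 = 0" and even: "\<And>x. \<Phi> (- x) = \<Phi> x"
    using assms by (auto simp: N_function_def)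
  then show "0 \<in> orlicz_space \<Phi> X"
    by (auto simp: orlicz_space_def orlicz_modular_def intro: exI [of _ 1])
  show "- f \<in> orlicz_space \<Phi> X" if "f \<in> orlicz_space \<Phi> X"
    using that by (auto simp: orlicz_space_def orlicz_modular_def even)
qed

section \<open>First cohomology\<close>

text \<open>For a \<open>G\<close>-module with underlying space \<open>V\<close> and action \<open>\<pi>\<close>. Cocycles are extensional functions
  on the carrier of \<open>G\<close>. No continuity is involved, so \<open>H\<^sup>1\<close> does not depend on the
  norm of \<open>V\<close>, and its vanishing is that of the underlying additive group.\<close>

definition Z1 :: "('g, 'm) monoid_scheme \<Rightarrow> 'v::ab_group_add set \<Rightarrow> ('g \<Rightarrow> 'v \<Rightarrow> 'v) \<Rightarrow> ('g \<Rightarrow> 'v) set" where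
  "Z1 G V \<pi> = {b \<in> carrier G \<rightarrow>\<^sub>E V.
     \<forall>g\<in>carrier G. \<forall>h\<in>carrier G. b (g \<otimes>\<^bsub>G\<^esub> h) = b g + \<pi> g (b h)}"

definition B1 :: "('g, 'm) monoid_scheme \<Rightarrow> 'v::ab_group_add set \<Rightarrow> ('g \<Rightarrow> 'v \<Rightarrow> 'v) \<Rightarrow> ('g \<Rightarrow> 'v) set" where
  "B1 G V \<pi> = {b \<in> Z1 G V \<pi>. \<exists>v\<in>V. \<forall>g\<in>carrier G. b g = \<pi> g v - v}"

definition Z1_group ::
    "('g, 'm) monoid_scheme \<Rightarrow> 'v::ab_group_add set \<Rightarrow> ('g \<Rightarrow> 'v \<Rightarrow> 'v) \<Rightarrow> ('g \<Rightarrow> 'v) monoid" where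
  "Z1_group G V \<pi> =
     \<lparr> carrier = Z1 G V \<pi>, monoid.mult = (\<lambda>b c. \<lambda>g\<in>carrier G. b g + c g), one = (\<lambda>g\<in>carrier G. 0) \<rparr>"

definition H1 ::
    "('g, 'm) monoid_scheme \<Rightarrow> 'v::ab_group_add set \<Rightarrow> ('g \<Rightarrow> 'v \<Rightarrow> 'v) \<Rightarrow> ('g \<Rightarrow> 'v) set monoid" where
  "H1 G V \<pi> = Z1_group G V \<pi> Mod B1 G V \<pi>"

lemma group_H1:
  assumes G: "group G"
    and zero: "0 \<in> V" and add: "\<And>v w. v \<in> V \<Longrightarrow> w \<in> V \<Longrightarrow> v + w \<in> V"
    and minus: "\<And>v. v \<in> V \<Longrightarrow> - v \<in> V"
    and \<pi>_add: "\<And>g v w. g \<in> carrier G \<Longrightarrow> v \<in> V \<Longrightarrow> w \<in> V \<Longrightarrow> \<pi> g (v + w) = \<pi> g v + \<pi> g w"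
  shows "group (H1 G V \<pi>)"
proof -
  interpret group G by fact
  have \<pi>_zero: "\<pi> g 0 = 0" if "g \<in> carrier G" for g
    using \<pi>_add [OF that zero zero] by simp
  have \<pi>_minus: "\<pi> g (- v) = - \<pi> g v" if "g \<in> carrier G" "v \<in> V" for g v
    using \<pi>_add [OF that(1) that(2) minus [OF that(2)]] \<pi>_zero [OF that(1)]
    by (simp add: eq_neg_iff_add_eq_0 add.commute)
  have plus_mem: "(\<lambda>g\<in>carrier G. b g + c g) \<in> Z1 G V \<pi>" if "b \<in> Z1 G V \<pi>" "c \<in> Z1 G V \<pi>" for b c
    using that unfolding Z1_def by (auto simp: PiE_iff \<pi>_add add algebra_simps)
  have minus_mem: "(\<lambda>g\<in>carrier G. - b g) \<in> Z1 G V \<pi>" if "b \<in> Z1 G V \<pi>" for b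
    using that unfolding Z1_def by (auto simp: PiE_iff \<pi>_minus minus)
  have zero_mem: "(\<lambda>g\<in>carrier G. 0) \<in> Z1 G V \<pi>"
    unfolding Z1_def by (auto simp: \<pi>_zero zero)
  interpret Z: comm_group "Z1_group G V \<pi>"
  proof (rule comm_groupI)
    fix b assume b: "b \<in> carrier (Z1_group G V \<pi>)"
    show "\<exists>c\<in>carrier (Z1_group G V \<pi>). c \<otimes>\<^bsub>Z1_group G V \<pi>\<^esub> b = \<one>\<^bsub>Z1_group G V \<pi>\<^esub>"
      using b by (intro bexI [of _ "\<lambda>g\<in>carrier G. - b g"])
        (auto simp: Z1_group_def minus_mem cong: restrict_cong)
    show "\<one>\<^bsub>Z1_group G V \<pi>\<^esub> \<otimes>\<^bsub>Z1_group G V \<pi>\<^esub> b = b"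
      using b by (auto simp: Z1_group_def Z1_def fun_eq_iff PiE_iff extensional_def)
  qed (auto simp: Z1_group_def plus_mem zero_mem add.assoc add.commute fun_eq_iff)
  have inv_eq: "inv\<^bsub>Z1_group G V \<pi>\<^esub> b = (\<lambda>g\<in>carrier G. - b g)" if "b \<in> Z1 G V \<pi>" for b
    by (rule Z.inv_equality) (use that minus_mem in \<open>auto simp: Z1_group_def fun_eq_iff\<close>)
  have "subgroup (B1 G V \<pi>) (Z1_group G V \<pi>)"
  proof (rule Z.subgroupI)
    show "B1 G V \<pi> \<subseteq> carrier (Z1_group G V \<pi>)"
      by (auto simp: B1_def Z1_group_def)
    have "(\<lambda>g\<in>carrier G. 0) \<in> B1 G V \<pi>"
      unfolding B1_def using zero_mem zero \<pi>_zero by (auto intro!: bexI [of _ 0])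
    then show "B1 G V \<pi> \<noteq> {}" by blast
  next
    fix b assume "b \<in> B1 G V \<pi>"
    then obtain v where b: "b \<in> Z1 G V \<pi>" "v \<in> V" "\<forall>g\<in>carrier G. b g = \<pi> g v - v"
      by (auto simp: B1_def)
    then have "(\<lambda>g\<in>carrier G. - b g) \<in> B1 G V \<pi>"
      unfolding B1_def using minus_mem by (auto intro!: bexI [of _ "- v"] simp: \<pi>_minus minus)
    then show "inv\<^bsub>Z1_group G V \<pi>\<^esub> b \<in> B1 G V \<pi>"
      by (simp add: inv_eq b)
  next
    fix b c assume "b \<in> B1 G V \<pi>" "c \<in> B1 G V \<pi>"
    then obtain v w where "b \<in> Z1 G V \<pi>" "v \<in> V" "\<forall>g\<in>carrier G. b g = \<pi> g v - v"
      "c \<in> Z1 G V \<pi>" "w \<in> V" "\<forall>g\<in>carrier G. c g = \<pi> g w - w"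
      by (auto simp: B1_def)
    then have "(\<lambda>g\<in>carrier G. b g + c g) \<in> B1 G V \<pi>"
      unfolding B1_def using plus_mem by (auto intro!: bexI [of _ "v + w"] simp: \<pi>_add add)
    then show "b \<otimes>\<^bsub>Z1_group G V \<pi>\<^esub> c \<in> B1 G V \<pi>"
      by (simp add: Z1_group_def)
  qed
  then have "B1 G V \<pi> \<lhd> Z1_group G V \<pi>"
    by (rule Z.subgroup_imp_normal)
  then show ?thesis
    unfolding H1_def by (rule normal.factorgroup_is_group)
qed

lemma group_H1_orlicz:
  assumes "group G" "N_function \<Phi>"
  shows "group (H1 G (orlicz_space \<Phi> (carrier G)) (left_regular G))"
  by (rule group_H1)
    (auto simp: assms orlicz_space_add orlicz_space_zero_minus left_regular_def fun_eq_iff)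

end

theory Submission
  imports Defs
begin

text \<open>Write \<open>\<lambda>\<close> for the left regular representation, and \<open>\<iota>\<^sub>z\<close> for the embedding of \<open>G1\<close> as the
  coordinate \<open>z \<in> G2\<close> of \<open>G\<close>. Images of different coordinates commute, and each is an infinite,
  nonamenable group, so that a cocycle can be trivialised on one coordinate by means of another.

  Since \<open>G1\<close> is nonamenable, a finite subset \<open>F\<close> of \<open>\<iota>\<^sub>1(G1)\<close> moves every nonnegative summable
  function on \<open>G\<close> by a fixed proportion of its norm (\<open>nonamenable_l1_gap\<close>): almost
  invariant densities would converge to an invariant mean. Applied to \<open>\<Phi> \<circ> f\<close>, and
  with the doubling condition, this bounds the modular of \<open>f\<close> by those of \<open>\<lambda>(s) f - f\<close> for \<open>s \<in> F\<close>
  (\<open>l1_gap_imp_modular_gap\<close>).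

  Let \<open>b\<close> be a cocycle and \<open>y \<noteq> 1\<close>. If \<open>g \<in> \<iota>\<^sub>y(G1)\<close> and \<open>s \<in> F\<close>, then \<open>g\<close> and \<open>s\<close> commute, hence
  \<open>\<lambda>(s) b(g) - b(g) = \<lambda>(g) b(s) - b(s)\<close>, and the gap makes \<open>b\<close> bounded on \<open>\<iota>\<^sub>y(G1)\<close>
  (\<open>cocycle_bounded_on_commuting_set\<close>). A pointwise limit of \<open>- b(g)\<close> as \<open>g\<close> tends to infinity
  in \<open>\<iota>\<^sub>y(G1)\<close> lies in the Orlicz space by Fatou's lemma, and its coboundary agrees with \<open>b\<close> on the
  centralizer of \<open>\<iota>\<^sub>y(G1)\<close> (\<open>cocycle_coboundary_on_centralizer\<close>).

  After subtracting this coboundary, \<open>b\<close> vanishes on all coordinates other than \<open>y\<close>. An infinite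
  group fixes no nonzero function in the Orlicz space, so zeros of \<open>b\<close> spread to elements that
  conjugate infinitely many zeros to zeros (\<open>cocycle_zero_if_conjugates_zeros\<close>): to the
  coordinate \<open>y\<close>, which commutes with the coordinate \<open>1\<close>, and then to every \<open>g \<in> G\<close>, because
  conjugation by \<open>g\<close> permutes the coordinate subgroups.\<close>

section \<open>N-functions\<close>

lemma N_function_zero [simp]: "N_function \<Phi> \<Longrightarrow> \<Phi> 0 = 0"
  by (auto simp: N_function_def)

lemma N_function_nonneg: "N_function \<Phi> \<Longrightarrow> 0 \<le> \<Phi> x"
  by (rule N_function_mono(1) [of \<Phi> x x]) simp_all

lemma N_function_abs: "N_function \<Phi> \<Longrightarrow> \<Phi> \<bar>x\<bar> = \<Phi> x"
  by (auto simp: N_function_def)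

lemma N_function_pos:
  assumes "N_function \<Phi>" "x \<noteq> 0"
  shows "0 < \<Phi> x"
proof -
  obtain \<phi> :: "real \<Rightarrow> real" where \<phi>: "mono_on {0..} \<phi>" "\<phi> 0 = 0" "\<forall>t>0. \<phi> t > 0"
    and \<Phi>: "\<forall>x. \<Phi> x = integral {0..\<bar>x\<bar>} \<phi>"
    using assms(1) unfolding N_function_def by blast
  define c where "c = \<bar>x\<bar>"
  have c: "c > 0" using assms(2) by (simp add: c_def)
  have int: "\<phi> integrable_on {a..b}" if "0 \<le> a" for a b
    by (rule integrable_on_mono_on) (rule mono_on_subset [OF \<phi>(1)], use that in auto)
  have nn: "0 \<le> \<phi> t" if "0 \<le> t" for t
    using \<phi>(2,3) that by (cases "t = 0") (auto intro: less_imp_le)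
  have "0 < (c - c / 2) * \<phi> (c / 2)" using c \<phi>(3) by simp
  also have "\<dots> = integral {c / 2..c} (\<lambda>_. \<phi> (c / 2))" using c by simp
  also have "\<dots> \<le> integral {c / 2..c} \<phi>"
    using c by (intro integral_le int) (auto intro: mono_onD [OF \<phi>(1)])
  also have "\<dots> \<le> integral {0..c} \<phi>"
    using c nn by (intro integral_subset_le int) auto
  finally show ?thesis using \<Phi> by (simp add: c_def)
qed

text \<open>This is the convexity of \<open>\<Phi>\<close>, free of its density \<open>\<phi>\<close>: on \<open>[l, m]\<close> the density
  is at most \<open>\<phi> m\<close>, on \<open>[m, 2m]\<close> it is at least \<open>\<phi> m\<close>.\<close>

lemma N_function_diff_le:
  assumes "N_function \<Phi>" "0 \<le> l" "l \<le> m"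
  shows "m * (\<Phi> m - \<Phi> l) \<le> (m - l) * (\<Phi> (2 * m) - \<Phi> m)"
proof -
  obtain \<phi> :: "real \<Rightarrow> real" where \<phi>: "mono_on {0..} \<phi>"
    and \<Phi>: "\<forall>x. \<Phi> x = integral {0..\<bar>x\<bar>} \<phi>"
    using assms(1) unfolding N_function_def by blast
  have int: "\<phi> integrable_on {a..b}" if "0 \<le> a" for a b
    by (rule integrable_on_mono_on) (rule mono_on_subset [OF \<phi>(1)], use that in auto)
  have split: "\<Phi> b - \<Phi> a = integral {a..b} \<phi>" if "0 \<le> a" "a \<le> b" for a b
    using Henstock_Kurzweil_Integration.integral_combine [of 0 a b \<phi>] that int [of 0 b] \<Phi> by simp
  have "integral {l..m} \<phi> \<le> integral {l..m} (\<lambda>_. \<phi> m)"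
    using assms by (intro integral_le int) (auto intro: mono_onD [OF \<phi>(1)])
  then have "m * (\<Phi> m - \<Phi> l) \<le> m * ((m - l) * \<phi> m)"
    using assms split [of l m] by (intro mult_left_mono) auto
  also have "\<dots> = (m - l) * integral {m..2 * m} (\<lambda>_. \<phi> m)"
    using assms by simp
  also have "\<dots> \<le> (m - l) * integral {m..2 * m} \<phi>"
    using assms by (intro mult_left_mono integral_le int) (auto intro: mono_onD [OF \<phi>(1)])
  finally show ?thesis
    using assms split [of m "2 * m"] by simp
qed

lemma N_function_half:
  assumes "N_function \<Phi>"
  shows "2 * \<Phi> (x / 2) \<le> \<Phi> x"
proof (cases "x = 0")
  case False
  have "\<bar>x\<bar> / 2 * (\<Phi> (\<bar>x\<bar> / 2) - \<Phi> 0) \<le> \<bar>x\<bar> / 2 * (\<Phi> \<bar>x\<bar> - \<Phi> (\<bar>x\<bar> / 2))"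
    using N_function_diff_le [OF assms, of 0 "\<bar>x\<bar> / 2"] by simp
  then have "\<Phi> (\<bar>x\<bar> / 2) - \<Phi> 0 \<le> \<Phi> \<bar>x\<bar> - \<Phi> (\<bar>x\<bar> / 2)"
    using False by simp
  moreover have "\<Phi> (\<bar>x\<bar> / 2) = \<Phi> (x / 2)" using N_function_abs [OF assms, of "x / 2"] by simp
  ultimately show ?thesis
    using assms by (simp add: N_function_abs)
qed (simp add: assms)

lemma N_function_scale_down:
  assumes "N_function \<Phi>"
  shows "2 ^ n * \<Phi> (x / 2 ^ n) \<le> \<Phi> x"
proof (induction n)
  case (Suc n)
  have "2 ^ Suc n * \<Phi> (x / 2 ^ Suc n) = 2 ^ n * (2 * \<Phi> ((x / 2 ^ n) / 2))"
    by (simp add: mult.commute)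
  also have "\<dots> \<le> 2 ^ n * \<Phi> (x / 2 ^ n)"
    by (intro mult_left_mono N_function_half assms) simp
  also have "\<dots> \<le> \<Phi> x" by (rule Suc.IH)
  finally show ?case .
qed simp

lemma N_function_unbounded:
  assumes "N_function \<Phi>"
  obtains M where "0 < M" "B < \<Phi> M"
proof -
  have pos: "0 < \<Phi> 1" by (rule N_function_pos [OF assms]) simp
  obtain n where n: "B / \<Phi> 1 < 2 ^ n" using real_arch_pow [of 2 "B / \<Phi> 1"] by auto
  have "B < 2 ^ n * \<Phi> 1" using n pos by (simp add: field_simps)
  also have "\<dots> \<le> \<Phi> (2 ^ n)" using N_function_scale_down [OF assms, of n "2 ^ n"] by simp
  finally show thesis using that [of "2 ^ n"] by simp
qed

lemma N_function_le_imp_bounded: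
  assumes "N_function \<Phi>" "\<Phi> x \<le> B" "B < \<Phi> M" "0 < M"
  shows "\<bar>x\<bar> \<le> M"
proof (rule ccontr)
  assume "\<not> \<bar>x\<bar> \<le> M"
  then have "\<Phi> M \<le> \<Phi> x" using assms(4) by (intro N_function_mono(2) [OF assms(1)]) simp
  then show False using assms by simp
qed

lemma N_function_diff_le_sum:
  assumes "N_function \<Phi>"
  shows "\<Phi> (a - b) \<le> \<Phi> (2 * a) + \<Phi> (2 * b)"
proof -
  have "\<bar>a - b\<bar> \<le> \<bar>2 * a\<bar> \<or> \<bar>a - b\<bar> \<le> \<bar>2 * b\<bar>" by linarith
  then have "\<Phi> (a - b) \<le> \<Phi> (2 * a) \<or> \<Phi> (a - b) \<le> \<Phi> (2 * b)"
    using N_function_mono(2) [OF assms] by blast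
  then show ?thesis
    using N_function_nonneg [OF assms, of "2 * a"] N_function_nonneg [OF assms, of "2 * b"] by linarith
qed

text \<open>Doubling near \<open>0\<close> extends to every bounded range, because there, away from \<open>0\<close>, \<open>\<Phi> (2 * x)\<close> is
  bounded above and \<open>\<Phi> x\<close> is bounded below. This suffices for Orlicz spaces over discrete
  sets, whose elements are bounded functions.\<close>

lemma Delta2_bounded_doubling:
  assumes "N_function \<Phi>" "Delta2_at_0 \<Phi>"
  obtains K where "1 \<le> K" "\<And>x. \<bar>x\<bar> \<le> M \<Longrightarrow> \<Phi> (2 * x) \<le> K * \<Phi> x"
proof -
  obtain x0 K0 where x0: "x0 > 0" "K0 > 2" "\<And>x. 0 \<le> x \<Longrightarrow> x \<le> x0 \<Longrightarrow> \<Phi> (2 * x) \<le> K0 * \<Phi> x"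
    using assms(2) unfolding Delta2_at_0_def by blast
  have pos: "0 < \<Phi> x0" using x0 by (intro N_function_pos assms) auto
  define K where "K = max K0 (\<Phi> (2 * M) / \<Phi> x0)"
  have "\<Phi> (2 * x) \<le> K * \<Phi> x" if "\<bar>x\<bar> \<le> M" for x
  proof (cases "\<bar>x\<bar> \<le> x0")
    case True
    have "\<Phi> (2 * x) = \<Phi> (2 * \<bar>x\<bar>)" using N_function_abs [OF assms(1), of "2 * x"] by (simp add: abs_mult)
    also have "\<dots> \<le> K0 * \<Phi> \<bar>x\<bar>" using True by (intro x0) auto
    also have "\<dots> \<le> K * \<Phi> \<bar>x\<bar>"
      by (intro mult_right_mono N_function_nonneg assms) (simp add: K_def)
    finally show ?thesis by (simp add: N_function_abs assms)
  next
    case False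
    have "\<Phi> (2 * x) \<le> \<Phi> (2 * M)" using that by (intro N_function_mono(2) [OF assms(1)]) simp
    also have "\<dots> = \<Phi> (2 * M) / \<Phi> x0 * \<Phi> x0" using pos by simp
    also have "\<dots> \<le> K * \<Phi> x0" using pos by (intro mult_right_mono) (auto simp: K_def)
    also have "\<dots> \<le> K * \<Phi> x"
      using False x0 by (intro mult_left_mono N_function_mono(2) [OF assms(1)]) (auto simp: K_def)
    finally show ?thesis .
  qed
  moreover have "1 \<le> K" using x0 by (simp add: K_def)
  ultimately show thesis by (rule that [rotated])
qed

lemma Delta2_bounded_doubling_power:
  assumes "N_function \<Phi>" "Delta2_at_0 \<Phi>"
  shows "\<exists>K\<ge>1. \<forall>x. \<bar>x\<bar> \<le> M \<longrightarrow> \<Phi> (2 ^ n * x) \<le> K * \<Phi> x"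
proof (induction n)
  case 0
  show ?case by (intro exI [of _ 1]) simp
next
  case (Suc n)
  then obtain K where K: "K \<ge> 1" "\<And>x. \<bar>x\<bar> \<le> M \<Longrightarrow> \<Phi> (2 ^ n * x) \<le> K * \<Phi> x" by blast
  obtain L where L: "1 \<le> L" "\<And>x. \<bar>x\<bar> \<le> 2 ^ n * M \<Longrightarrow> \<Phi> (2 * x) \<le> L * \<Phi> x"
    using Delta2_bounded_doubling [OF assms] by blast
  have "\<Phi> (2 ^ Suc n * x) \<le> L * K * \<Phi> x" if "\<bar>x\<bar> \<le> M" for x
  proof -
    have "\<Phi> (2 ^ Suc n * x) = \<Phi> (2 * (2 ^ n * x))" by (simp add: mult.assoc)
    also have "\<dots> \<le> L * \<Phi> (2 ^ n * x)" using that by (intro L) (simp add: abs_mult)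
    also have "\<dots> \<le> L * (K * \<Phi> x)" using that L K by (intro mult_left_mono) auto
    finally show ?thesis by simp
  qed
  moreover have "1 \<le> L * K" using L(1) K(1) mult_mono [of 1 L 1 K] by simp
  ultimately show ?case by blast
qed

text \<open>If \<open>a\<close> and \<open>b\<close> are close relative to their size, the difference quotient bound and doubling
  make the left side a small multiple of \<open>\<Phi> a + \<Phi> b\<close>. Otherwise \<open>\<bar>a\<bar>\<close> and \<open>\<bar>b\<bar>\<close> are at most
  a fixed multiple of \<open>\<bar>a - b\<bar>\<close>, and doubling bounds the left side by a multiple of \<open>\<Phi> (a - b)\<close>.\<close>

lemma N_function_perturbation:
  assumes "N_function \<Phi>" "Delta2_at_0 \<Phi>" and \<delta>: "0 < \<delta>"
  obtains C where "0 < C"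
    "\<And>a b. \<bar>a\<bar> \<le> M \<Longrightarrow> \<bar>b\<bar> \<le> M \<Longrightarrow> \<bar>\<Phi> a - \<Phi> b\<bar> \<le> \<delta> * (\<Phi> a + \<Phi> b) + C * \<Phi> (a - b)"
proof -
  note nn = N_function_nonneg [OF assms(1)]
  obtain K where K: "1 \<le> K" "\<And>x. \<bar>x\<bar> \<le> M \<Longrightarrow> \<Phi> (2 * x) \<le> K * \<Phi> x"
    using Delta2_bounded_doubling [OF assms(1,2)] by blast
  define \<eta> where "\<eta> = \<delta> / K"
  have \<eta>: "0 < \<eta>" using \<delta> K by (simp add: \<eta>_def)
  obtain n where n: "1 / \<eta> < 2 ^ n" using real_arch_pow [of 2 "1 / \<eta>"] by auto
  obtain C where C: "C \<ge> 1" "\<And>x. \<bar>x\<bar> \<le> M \<Longrightarrow> \<Phi> (2 ^ n * x) \<le> C * \<Phi> x"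
    using Delta2_bounded_doubling_power [OF assms(1,2)] by blast
  have main: "\<Phi> m - \<Phi> l \<le> \<delta> * (\<Phi> m + \<Phi> l) + C * \<Phi> (m - l)" if "0 \<le> l" "l \<le> m" "m \<le> M" for l m
  proof (cases "m - l \<le> \<eta> * m")
    case True
    have "\<Phi> m - \<Phi> l \<le> \<delta> * \<Phi> m"
    proof (cases "m = 0")
      case False
      then have m: "m > 0" using that by simp
      have "m * (\<Phi> m - \<Phi> l) \<le> (m - l) * (\<Phi> (2 * m) - \<Phi> m)"
        using that by (intro N_function_diff_le assms)
      also have "\<dots> \<le> (m - l) * (K * \<Phi> m)"
        using that K(2) [of m] nn [of m] by (intro mult_left_mono) auto
      also have "\<dots> \<le> (\<eta> * m) * (K * \<Phi> m)"
        using True K nn by (intro mult_right_mono) auto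
      also have "\<dots> = m * (\<delta> * \<Phi> m)" using K by (simp add: \<eta>_def)
      finally show ?thesis using m by simp
    qed (use that assms in simp)
    then show ?thesis using nn [of l] nn [of "m - l"] \<delta> C by (simp add: distrib_left add_increasing2)
  next
    case False
    then have "m \<le> (1 / \<eta>) * (m - l)" using \<eta> by (simp add: field_simps)
    also have "\<dots> \<le> 2 ^ n * (m - l)" using n that by (intro mult_right_mono) auto
    finally have "\<Phi> m \<le> \<Phi> (2 ^ n * (m - l))" using that by (intro N_function_mono(2) [OF assms(1)]) auto
    also have "\<dots> \<le> C * \<Phi> (m - l)" using that by (intro C) auto
    finally show ?thesis using nn [of l] nn [of m] \<delta>
      by (smt (verit) mult_nonneg_nonneg)
  qed
  have "\<bar>\<Phi> a - \<Phi> b\<bar> \<le> \<delta> * (\<Phi> a + \<Phi> b) + C * \<Phi> (a - b)" if "\<bar>a\<bar> \<le> M" "\<bar>b\<bar> \<le> M" for a b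
  proof -
    define m l where "m = max \<bar>a\<bar> \<bar>b\<bar>" and "l = min \<bar>a\<bar> \<bar>b\<bar>"
    have lm: "0 \<le> l" "l \<le> m" "m \<le> M" "\<bar>m - l\<bar> \<le> \<bar>a - b\<bar>"
      using that by (auto simp: m_def l_def)
    have sum: "\<Phi> a + \<Phi> b = \<Phi> m + \<Phi> l" and "\<bar>\<Phi> a - \<Phi> b\<bar> = \<Phi> m - \<Phi> l"
      using N_function_mono(2) [OF assms(1), of a b] N_function_mono(2) [OF assms(1), of b a]
      by (auto simp: m_def l_def max_def min_def N_function_abs assms)
    note this(2)
    also have "\<Phi> m - \<Phi> l \<le> \<delta> * (\<Phi> m + \<Phi> l) + C * \<Phi> (m - l)" by (rule main) (use lm in auto)
    also have "\<dots> \<le> \<delta> * (\<Phi> m + \<Phi> l) + C * \<Phi> (a - b)"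
      using lm C by (intro add_left_mono mult_left_mono N_function_mono(2) [OF assms(1)]) auto
    finally show ?thesis by (simp add: sum)
  qed
  then show thesis using that [of C] C by simp
qed

section \<open>Nonamenability as a spectral gap on summable functions\<close>

text \<open>Tychonoff's theorem, in the form in which invariant means and weak limits are obtained below:
  a uniformly pointwise bounded net of real functions has a pointwise convergent subnet.\<close>

lemma pointwise_convergent_subfilter:
  fixes m :: "'i \<Rightarrow> 'f \<Rightarrow> real"
  assumes "F \<noteq> bot" and bound: "\<forall>\<^sub>F i in F. \<forall>f. \<bar>m i f\<bar> \<le> B f"
  obtains F' l where "F' \<le> F" "F' \<noteq> bot" "\<And>f. ((\<lambda>i. m i f) \<longlongrightarrow> l f) F'"
proof -
  define U where "U = (\<Pi>\<^sub>E f\<in>UNIV. {- B f..B f})"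
  have "compactin (product_topology (\<lambda>_. euclidean) UNIV) U"
    unfolding U_def by (subst compactin_PiE) auto
  then have "compact U" by (simp add: euclidean_product_topology)
  moreover have "filtermap m F \<le> principal U"
    unfolding le_principal eventually_filtermap using bound
    by eventually_elim (auto simp: U_def abs_le_iff minus_le_iff)
  moreover have "filtermap m F \<noteq> bot" using assms(1) by (simp add: filtermap_bot_iff)
  ultimately obtain l where l: "inf (nhds l) (filtermap m F) \<noteq> bot"
    unfolding compact_filter le_principal by meson
  define F' where "F' = inf (filtercomap m (nhds l)) F"
  have "F' \<noteq> bot"
  proof
    assume "F' = bot"
    then have "eventually (\<lambda>_. False) (inf (filtercomap m (nhds l)) F)" by (simp add: F'_def)
    then obtain Q R where QR: "eventually Q (filtercomap m (nhds l))" "eventually R F"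
      "\<And>i. Q i \<Longrightarrow> R i \<Longrightarrow> False"
      unfolding eventually_inf by auto
    obtain P where P: "eventually P (nhds l)" "\<And>i. P (m i) \<Longrightarrow> Q i"
      using QR(1) unfolding eventually_filtercomap by blast
    have "eventually (\<lambda>x. \<not> P x) (filtermap m F)"
      unfolding eventually_filtermap using QR(2) by eventually_elim (use QR P in blast)
    then have "eventually (\<lambda>_. False) (inf (nhds l) (filtermap m F))"
      unfolding eventually_inf using P(1) by (intro exI [of _ P] exI [of _ "\<lambda>x. \<not> P x"]) simp
    with l show False by (simp add: trivial_limit_def)
  qed
  moreover have "F' \<le> F" by (simp add: F'_def)
  moreover have "((\<lambda>i. m i f) \<longlongrightarrow> l f) F'" for f
  proof -
    have lim: "(m \<longlongrightarrow> l) F'" unfolding F'_def filterlim_iff_le_filtercomap by (rule inf_le1)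
    show ?thesis
    proof (rule topological_tendstoI)
      fix V :: "real set" assume V: "open V" "l f \<in> V"
      have "open ((\<lambda>h :: 'f \<Rightarrow> real. h f) -` V)"
        using V(1) continuous_on_product_coordinates by (rule open_vimage)
      then show "\<forall>\<^sub>F i in F'. m i f \<in> V"
        using topological_tendstoD [OF lim] V(2) by fastforce
    qed
  qed
  ultimately show thesis using that by blast
qed

text \<open>The quantitative failure of Reiter's condition, with respect to the translations by \<open>F\<close>.\<close>

definition l1_gap :: "('g, 'm) monoid_scheme \<Rightarrow> 'g set \<Rightarrow> real \<Rightarrow> bool" where
  "l1_gap G F \<epsilon> \<longleftrightarrow>
     (\<forall>u. (\<forall>x\<in>carrier G. 0 \<le> u x) \<longrightarrow> u summable_on carrier G \<longrightarrow>
        \<epsilon> * (\<Sum>\<^sub>\<infinity>x\<in>carrier G. u x) \<le> (\<Sum>s\<in>F. \<Sum>\<^sub>\<infinity>x\<in>carrier G. \<bar>left_regular G s u x - u x\<bar>))"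

lemma bij_betw_left_mult:
  assumes "group G" "g \<in> carrier G"
  shows "bij_betw (\<lambda>x. g \<otimes>\<^bsub>G\<^esub> x) (carrier G) (carrier G)"
proof -
  interpret group G by fact
  show ?thesis using assms(2) by (simp add: bij_betw_def inj_on_def surj_const_mult)
qed

lemma summable_on_mult_bounded:
  fixes u h :: "'x \<Rightarrow> real"
  assumes "(\<lambda>x. \<bar>u x\<bar>) summable_on X" and h: "\<And>x. x \<in> X \<Longrightarrow> \<bar>h x\<bar> \<le> b"
  shows "(\<lambda>x. u x * h x) summable_on X"
    and "\<bar>\<Sum>\<^sub>\<infinity>x\<in>X. u x * h x\<bar> \<le> b * (\<Sum>\<^sub>\<infinity>x\<in>X. \<bar>u x\<bar>)"
proof -
  have le: "\<bar>u x * h x\<bar> \<le> b * \<bar>u x\<bar>" if "x \<in> X" for x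
    using mult_right_mono [OF h [OF that], of "\<bar>u x\<bar>"] by (simp add: abs_mult mult.commute)
  have sb: "(\<lambda>x. b * \<bar>u x\<bar>) summable_on X"
    by (rule summable_on_cmult_right) (rule assms)
  have abs: "(\<lambda>x. \<bar>u x * h x\<bar>) summable_on X"
    by (rule summable_on_comparison_test [OF sb le]) simp_all
  then show "(\<lambda>x. u x * h x) summable_on X"
    by (subst summable_on_iff_abs_summable_on_real) simp
  have "\<bar>\<Sum>\<^sub>\<infinity>x\<in>X. u x * h x\<bar> \<le> (\<Sum>\<^sub>\<infinity>x\<in>X. \<bar>u x * h x\<bar>)"
    using norm_infsum_bound [of "\<lambda>x. u x * h x" X] abs by simp
  also have "\<dots> \<le> (\<Sum>\<^sub>\<infinity>x\<in>X. b * \<bar>u x\<bar>)" by (rule infsum_mono [OF abs sb le])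
  also have "\<dots> = b * (\<Sum>\<^sub>\<infinity>x\<in>X. \<bar>u x\<bar>)" by (rule infsum_cmult_right) (rule assms)
  finally show "\<bar>\<Sum>\<^sub>\<infinity>x\<in>X. u x * h x\<bar> \<le> b * (\<Sum>\<^sub>\<infinity>x\<in>X. \<bar>u x\<bar>)" .
qed

lemma bounded_functionsD:
  assumes "f \<in> bounded_functions X"
  obtains b where "0 \<le> b" "\<And>x. \<bar>f x\<bar> \<le> b"
proof -
  obtain b where b: "\<And>x. x \<in> X \<Longrightarrow> \<bar>f x\<bar> \<le> b" and z: "\<And>x. x \<notin> X \<Longrightarrow> f x = 0"
    using assms unfolding bounded_functions_def by (auto simp: bounded_iff)
  have "\<bar>f x\<bar> \<le> max b 0" for x using b [of x] z [of x] by (cases "x \<in> X") auto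
  then show thesis using that [of "max b 0"] by simp
qed

lemma bounded_functionsI:
  assumes "\<And>x. x \<notin> X \<Longrightarrow> f x = 0" "\<And>x. \<bar>f x\<bar> \<le> b"
  shows "f \<in> bounded_functions X"
  unfolding bounded_functions_def bounded_iff using assms by auto

text \<open>Without a gap there are probability densities on \<open>G\<close> that are almost invariant
  under any given finite subset of \<open>K\<close>. The equivariant map \<open>p\<close> pushes them forward to \<open>K\<close>, and a limit
  of the resulting averages is an invariant mean. Pushing forward replaces a decomposition
  of \<open>G\<close> into \<open>K\<close>-orbits.\<close>

lemma nonamenable_l1_gap:
  fixes K :: "('k, 'c) monoid_scheme" and G :: "('g, 'm) monoid_scheme"
  assumes "group K" "group G" and \<iota>: "\<iota> \<in> hom K G"
    and p: "\<And>x. x \<in> carrier G \<Longrightarrow> p x \<in> carrier K"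
    and equi: "\<And>k x. k \<in> carrier K \<Longrightarrow> x \<in> carrier G \<Longrightarrow> p (\<iota> k \<otimes>\<^bsub>G\<^esub> x) = k \<otimes>\<^bsub>K\<^esub> p x"
    and "\<not> amenable K"
  obtains F \<epsilon> where "finite F" "F \<subseteq> \<iota> ` carrier K" "0 < \<epsilon>" "l1_gap G F \<epsilon>"
proof (rule ccontr)
  note gapI = that
  assume contra: "\<not> thesis"
  interpret K: group K by fact
  interpret G: group G by fact
  interpret \<iota>: group_hom K G \<iota> by unfold_locales (rule \<iota>)
  let ?BF = "bounded_functions (carrier K)"
  define D where "D s u = (\<Sum>\<^sub>\<infinity>x\<in>carrier G. \<bar>left_regular G s u x - u x\<bar>)" for s u
  have D_nonneg: "0 \<le> D s u" for s u unfolding D_def by (rule infsum_nonneg) simp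
  \<comment> \<open>almost invariant densities, with \<open>A\<close> the set of translations and \<open>1 / Suc n\<close> the error\<close>
  have "\<exists>u. (\<forall>x\<in>carrier G. 0 \<le> u x) \<and> u summable_on carrier G \<and> (\<Sum>\<^sub>\<infinity>x\<in>carrier G. u x) = 1 \<and>
      (\<forall>s\<in>\<iota> ` A. D s u \<le> 1 / real (Suc n))" if A: "finite A" "A \<subseteq> carrier K" for A n
  proof -
    have "\<not> l1_gap G (\<iota> ` A) (1 / real (Suc n))" using contra gapI [of "\<iota> ` A" "1 / real (Suc n)"] A by auto
    then obtain u where u: "\<And>x. x \<in> carrier G \<Longrightarrow> 0 \<le> u x" "u summable_on carrier G"
      and lt: "(\<Sum>s\<in>\<iota> ` A. D s u) < 1 / real (Suc n) * (\<Sum>\<^sub>\<infinity>x\<in>carrier G. u x)"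
      unfolding l1_gap_def D_def by (auto simp: not_le)
    define S where "S = (\<Sum>\<^sub>\<infinity>x\<in>carrier G. u x)"
    have "0 \<le> (\<Sum>s\<in>\<iota> ` A. D s u)" by (rule sum_nonneg) (rule D_nonneg)
    with lt have "0 < 1 / real (Suc n) * S" unfolding S_def by linarith
    then have S: "0 < S" by (simp add: zero_less_divide_iff)
    define w where "w x = (1 / S) * u x" for x
    have Dw: "D s w = (1 / S) * D s u" for s
    proof -
      have "left_regular G s w x - w x = (1 / S) * (left_regular G s u x - u x)" for x
        by (simp add: left_regular_def w_def right_diff_distrib)
      then have "\<bar>left_regular G s w x - w x\<bar> = (1 / S) * \<bar>left_regular G s u x - u x\<bar>" for x
        using S by (simp only: abs_mult) simp
      then show ?thesis unfolding D_def by (simp only: infsum_cmult_right')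
    qed
    have "D s w \<le> 1 / real (Suc n)" if s: "s \<in> \<iota> ` A" for s
    proof -
      have "D s u \<le> (\<Sum>s\<in>\<iota> ` A. D s u)" using s A D_nonneg by (intro member_le_sum) auto
      then have "D s u \<le> 1 / real (Suc n) * S" using lt unfolding S_def by linarith
      then show ?thesis using S unfolding Dw by (simp add: field_simps)
    qed
    moreover have "(\<Sum>\<^sub>\<infinity>x\<in>carrier G. w x) = 1"
      using S unfolding w_def by (subst infsum_cmult_right') (simp add: S_def)
    moreover have "w summable_on carrier G" unfolding w_def by (intro summable_on_cmult_right u)
    moreover have "\<forall>x\<in>carrier G. 0 \<le> w x" using u S by (simp add: w_def)
    ultimately show ?thesis by (intro exI [of _ w]) simp
  qed
  then obtain u where u: "\<And>A n. finite A \<Longrightarrow> A \<subseteq> carrier K \<Longrightarrow>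
      (\<forall>x\<in>carrier G. 0 \<le> u A n x) \<and> u A n summable_on carrier G \<and> (\<Sum>\<^sub>\<infinity>x\<in>carrier G. u A n x) = 1 \<and>
      (\<forall>s\<in>\<iota> ` A. D s (u A n) \<le> 1 / real (Suc n))"
    by metis
  define ok where "ok i \<longleftrightarrow> finite (fst i) \<and> fst i \<subseteq> carrier K" for i :: "'k set \<times> nat"
  define w where "w i = u (fst i) (snd i)" for i
  have w: "x \<in> carrier G \<Longrightarrow> 0 \<le> w i x" "(\<lambda>x. \<bar>w i x\<bar>) summable_on carrier G"
      "(\<Sum>\<^sub>\<infinity>x\<in>carrier G. \<bar>w i x\<bar>) = 1" "k \<in> fst i \<Longrightarrow> D (\<iota> k) (w i) \<le> 1 / real (Suc (snd i))"
    if "ok i" for i x k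
  proof -
    have i: "finite (fst i)" "fst i \<subseteq> carrier K" using that by (auto simp: ok_def)
    note * = u [OF i, of "snd i", folded w_def]
    show "x \<in> carrier G \<Longrightarrow> 0 \<le> w i x" "k \<in> fst i \<Longrightarrow> D (\<iota> k) (w i) \<le> 1 / real (Suc (snd i))"
      using * by auto
    show "(\<lambda>x. \<bar>w i x\<bar>) summable_on carrier G" using * by (simp cong: summable_on_cong)
    show "(\<Sum>\<^sub>\<infinity>x\<in>carrier G. \<bar>w i x\<bar>) = 1" using * by (simp cong: infsum_cong)
  qed
  define Fl where "Fl = finite_subsets_at_top (carrier K) \<times>\<^sub>F (sequentially :: nat filter)"
  have "Fl \<noteq> bot" unfolding Fl_def by (simp add: prod_filter_eq_bot)
  have ev_fst: "\<forall>\<^sub>F i in Fl. P (fst i)" if "eventually P (finite_subsets_at_top (carrier K))" for P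
    unfolding Fl_def using eventually_prodI [OF that eventually_True] by simp
  have ev_ok: "\<forall>\<^sub>F i in Fl. ok i"
  proof -
    have "\<forall>\<^sub>F A in finite_subsets_at_top (carrier K). finite A \<and> A \<subseteq> carrier K"
      by (rule eventually_finite_subsets_at_top_weakI) auto
    then show ?thesis unfolding ok_def by (rule ev_fst)
  qed
  define m where "m i f = (if f \<in> ?BF then \<Sum>\<^sub>\<infinity>x\<in>carrier G. w i x * f (p x) else 0)" for i f
  have "\<exists>b. f \<in> ?BF \<longrightarrow> (0 \<le> b \<and> (\<forall>x. \<bar>f x\<bar> \<le> b))" for f
    using bounded_functionsD by metis
  then obtain B where B: "\<And>f. f \<in> ?BF \<Longrightarrow> 0 \<le> B f" "\<And>f x. f \<in> ?BF \<Longrightarrow> \<bar>f x\<bar> \<le> B f"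
    by metis
  have summ: "(\<lambda>x. w i x * f (p x)) summable_on carrier G" if "ok i" "f \<in> ?BF" for i f
    by (rule summable_on_mult_bounded(1) [OF w(2) [OF that(1)]]) (rule B(2) [OF that(2)])
  have bound: "\<forall>\<^sub>F i in Fl. \<forall>f. \<bar>m i f\<bar> \<le> (if f \<in> ?BF then B f else 0)"
    using ev_ok
  proof eventually_elim
    case (elim i)
    show ?case
      using summable_on_mult_bounded(2) [OF w(2) [OF elim], of "\<lambda>x. _ (p x)"] w(3) [OF elim] B
      by (auto simp: m_def)
  qed
  obtain F' l where F': "F' \<le> Fl" "F' \<noteq> bot" and l: "\<And>f. ((\<lambda>i. m i f) \<longlongrightarrow> l f) F'"
    using pointwise_convergent_subfilter [OF \<open>Fl \<noteq> bot\<close> bound] by blast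
  have ok': "\<forall>\<^sub>F i in F'. ok i" using ev_ok F'(1) by (rule filter_leD [rotated])
  have "amenable K"
    unfolding amenable_def
  proof (intro exI [of _ l] conjI ballI allI impI)
    fix f f' assume f: "f \<in> ?BF" "f' \<in> ?BF"
    have "f + f' \<in> ?BF"
    proof (rule bounded_functionsI)
      show "(f + f') x = 0" if "x \<notin> carrier K" for x using f that by (simp add: bounded_functions_def)
      show "\<bar>(f + f') x\<bar> \<le> B f + B f'" for x using B(2) [OF f(1), of x] B(2) [OF f(2), of x] by simp
    qed
    note sum = this
    have "\<forall>\<^sub>F i in F'. m i f + m i f' = m i (f + f')"
      using ok' by eventually_elim (use f sum in \<open>simp add: m_def distrib_left infsum_add summ\<close>)
    then have "((\<lambda>i. m i (f + f')) \<longlongrightarrow> l f + l f') F'"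
      by (rule Lim_transform_eventually [OF tendsto_add [OF l l]])
    then show "l (f + f') = l f + l f'" using l [of "f + f'"] F'(2) tendsto_unique by blast
  next
    fix c f assume f: "f \<in> ?BF"
    have "(\<lambda>x. c * f x) \<in> ?BF"
    proof (rule bounded_functionsI)
      show "c * f x = 0" if "x \<notin> carrier K" for x using f that by (simp add: bounded_functions_def)
      show "\<bar>c * f x\<bar> \<le> \<bar>c\<bar> * B f" for x
        using B(2) [OF f, of x] by (simp add: abs_mult mult_left_mono)
    qed
    then have "c * m i f = m i (\<lambda>x. c * f x)" for i
      using f by (simp add: m_def mult.left_commute infsum_cmult_right')
    then have "((\<lambda>i. m i (\<lambda>x. c * f x)) \<longlongrightarrow> c * l f) F'"
      using tendsto_mult_left [OF l, of c f] by simp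
    then show "l (\<lambda>x. c * f x) = c * l f" using l F'(2) tendsto_unique by blast
  next
    fix f assume f: "f \<in> ?BF" "\<forall>x. 0 \<le> f x"
    have "\<forall>\<^sub>F i in F'. 0 \<le> m i f"
      using ok' by eventually_elim (use f w in \<open>auto simp: m_def intro!: infsum_nonneg\<close>)
    then show "0 \<le> l f" using l F'(2) tendsto_lowerbound by blast
  next
    have ind: "indicator (carrier K) \<in> ?BF"
      by (rule bounded_functionsI [where b = 1]) (auto simp: indicator_def)
    have "\<forall>\<^sub>F i in F'. 1 = m i (indicator (carrier K))"
      using ok'
    proof eventually_elim
      case (elim i)
      have "m i (indicator (carrier K)) = (\<Sum>\<^sub>\<infinity>x\<in>carrier G. \<bar>w i x\<bar>)"
        using ind w(1) [OF elim] p by (auto simp: m_def intro!: infsum_cong)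
      then show ?case using w(3) [OF elim] by simp
    qed
    then have "((\<lambda>i. m i (indicator (carrier K))) \<longlongrightarrow> 1) F'"
      by (rule Lim_transform_eventually [OF tendsto_const])
    then show "l (indicator (carrier K)) = 1" using l F'(2) tendsto_unique by blast
  next
    fix g f assume g: "g \<in> carrier K" and f: "f \<in> ?BF"
    have gf: "left_regular K g f \<in> ?BF"
      by (rule bounded_functionsI [where b = "B f"]) (use B [OF f] in \<open>auto simp: left_regular_def\<close>)
    have \<iota>g: "\<iota> g \<in> carrier G" using g by simp
    have le: "\<bar>m i (left_regular K g f) - m i f\<bar> \<le> B f * (1 / real (Suc (snd i)))"
      if i: "ok i" "inv\<^bsub>K\<^esub> g \<in> fst i" for i
    proof -
      have bij: "bij_betw (\<lambda>x. \<iota> g \<otimes>\<^bsub>G\<^esub> x) (carrier G) (carrier G)"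
        by (rule bij_betw_left_mult) (use \<iota>g assms in auto)
      have eq: "left_regular K g f (p (\<iota> g \<otimes>\<^bsub>G\<^esub> x)) = f (p x)" if "x \<in> carrier G" for x
        using that g by (simp add: equi p left_regular_def flip: K.m_assoc)
      have shift: "left_regular G (\<iota> (inv\<^bsub>K\<^esub> g)) h x = h (\<iota> g \<otimes>\<^bsub>G\<^esub> x)" if "x \<in> carrier G" for h :: "'g \<Rightarrow> real" and x
        using that g by (simp add: left_regular_def)
      have s: "(\<lambda>x. \<bar>w i (\<iota> g \<otimes>\<^bsub>G\<^esub> x)\<bar>) summable_on carrier G"
        using w(2) [OF i(1)] summable_on_reindex_bij_betw [OF bij, of "\<lambda>x. \<bar>w i x\<bar>"] by simp
      then have s': "(\<lambda>x. \<bar>w i (\<iota> g \<otimes>\<^bsub>G\<^esub> x) - w i x\<bar>) summable_on carrier G"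
        by (rule summable_on_comparison_test [OF summable_on_add [OF _ w(2) [OF i(1)]]]) auto
      have "m i (left_regular K g f) = (\<Sum>\<^sub>\<infinity>x\<in>carrier G. w i x * left_regular K g f (p x))"
        using gf by (simp add: m_def)
      also have "\<dots> = (\<Sum>\<^sub>\<infinity>x\<in>carrier G. w i (\<iota> g \<otimes>\<^bsub>G\<^esub> x) * left_regular K g f (p (\<iota> g \<otimes>\<^bsub>G\<^esub> x)))"
        by (rule infsum_reindex_bij_betw [OF bij, symmetric])
      also have "\<dots> = (\<Sum>\<^sub>\<infinity>x\<in>carrier G. w i (\<iota> g \<otimes>\<^bsub>G\<^esub> x) * f (p x))"
        by (rule infsum_cong) (simp add: eq)
      finally have mg: "m i (left_regular K g f) = (\<Sum>\<^sub>\<infinity>x\<in>carrier G. w i (\<iota> g \<otimes>\<^bsub>G\<^esub> x) * f (p x))" .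
      have mf: "m i f = (\<Sum>\<^sub>\<infinity>x\<in>carrier G. w i x * f (p x))" using f by (simp add: m_def)
      have "(\<lambda>x. w i (\<iota> g \<otimes>\<^bsub>G\<^esub> x) * f (p x)) summable_on carrier G"
        by (rule summable_on_mult_bounded(1) [OF s]) (rule B(2) [OF f])
      then have "((\<lambda>x. w i (\<iota> g \<otimes>\<^bsub>G\<^esub> x) * f (p x) + - (w i x * f (p x))) has_sum
          (m i (left_regular K g f) + - m i f)) (carrier G)"
        using summ [OF i(1) f] unfolding mg mf
        by (intro has_sum_add has_sum_uminus [THEN iffD2]) auto
      then have "m i (left_regular K g f) - m i f
          = (\<Sum>\<^sub>\<infinity>x\<in>carrier G. w i (\<iota> g \<otimes>\<^bsub>G\<^esub> x) * f (p x) - w i x * f (p x))"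
        by (simp add: infsumI)
      also have "\<dots> = (\<Sum>\<^sub>\<infinity>x\<in>carrier G. (w i (\<iota> g \<otimes>\<^bsub>G\<^esub> x) - w i x) * f (p x))"
        by (simp add: left_diff_distrib)
      finally have "\<bar>m i (left_regular K g f) - m i f\<bar>
          \<le> B f * (\<Sum>\<^sub>\<infinity>x\<in>carrier G. \<bar>w i (\<iota> g \<otimes>\<^bsub>G\<^esub> x) - w i x\<bar>)"
        using summable_on_mult_bounded(2) [OF s', of "\<lambda>x. f (p x)" "B f"] B(2) [OF f] by simp
      also have "(\<Sum>\<^sub>\<infinity>x\<in>carrier G. \<bar>w i (\<iota> g \<otimes>\<^bsub>G\<^esub> x) - w i x\<bar>) = D (\<iota> (inv\<^bsub>K\<^esub> g)) (w i)"
        unfolding D_def by (rule infsum_cong) (simp add: shift)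
      also have "B f * \<dots> \<le> B f * (1 / real (Suc (snd i)))"
        using w(4) [OF i] B(1) [OF f] by (intro mult_left_mono) auto
      finally show ?thesis .
    qed
    have "\<forall>\<^sub>F A in finite_subsets_at_top (carrier K). inv\<^bsub>K\<^esub> g \<in> A"
      unfolding eventually_finite_subsets_at_top using g by (intro exI [of _ "{inv\<^bsub>K\<^esub> g}"]) auto
    then have "\<forall>\<^sub>F i in Fl. inv\<^bsub>K\<^esub> g \<in> fst i" by (rule ev_fst)
    then have "\<forall>\<^sub>F i in F'. inv\<^bsub>K\<^esub> g \<in> fst i" using F'(1) by (rule filter_leD [rotated])
    with ok' have ev: "\<forall>\<^sub>F i in F'. norm (m i (left_regular K g f) - m i f) \<le> B f * (1 / real (Suc (snd i)))"
      by eventually_elim (simp only: real_norm_def le)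
    have "filterlim snd sequentially Fl"
      unfolding filterlim_iff Fl_def
      using eventually_prodI [OF eventually_True, of _ sequentially "finite_subsets_at_top (carrier K)"] by simp
    then have "filterlim snd sequentially F'" using F'(1) by (rule filterlim_mono [OF _ order_refl])
    then have "((\<lambda>i. B f * (1 / real (Suc (snd i)))) \<longlongrightarrow> B f * 0) F'"
      by (intro tendsto_mult_left filterlim_compose [OF LIMSEQ_Suc [OF lim_1_over_n]])
    then have "((\<lambda>i. m i (left_regular K g f) - m i f) \<longlongrightarrow> 0) F'"
      by (intro Lim_null_comparison [OF ev]) simp
    moreover have "((\<lambda>i. m i (left_regular K g f) - m i f) \<longlongrightarrow> l (left_regular K g f) - l f) F'"
      by (intro tendsto_diff l)
    ultimately show "l (left_regular K g f) = l f"
      using tendsto_unique [OF F'(2)] by fastforce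
  qed
  then show False using assms by blast
qed

text \<open>Averaging over a finite group is an invariant mean.\<close>

lemma nonamenable_imp_infinite:
  assumes "group G" "\<not> amenable G"
  shows "infinite (carrier G)"
proof
  assume fin: "finite (carrier G)"
  interpret group G by fact
  define m where "m f = (\<Sum>x\<in>carrier G. f x) / real (card (carrier G))" for f :: "_ \<Rightarrow> real"
  have card: "0 < card (carrier G)" using fin one_closed card_gt_0_iff by blast
  have "m (left_regular G g f) = m f" if "g \<in> carrier G" for g f
  proof -
    have "(\<Sum>x\<in>carrier G. left_regular G g f x) = (\<Sum>x\<in>carrier G. f (inv\<^bsub>G\<^esub> g \<otimes>\<^bsub>G\<^esub> x))"
      by (rule sum.cong) (simp_all add: left_regular_def)
    also have "\<dots> = (\<Sum>x\<in>carrier G. f x)"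
      by (rule sum.reindex_bij_betw, rule bij_betw_left_mult) (use that assms in auto)
    finally show ?thesis by (simp add: m_def)
  qed
  then have "amenable G" unfolding amenable_def
    using card by (intro exI [of _ m])
      (simp add: m_def sum.distrib add_divide_distrib sum_nonneg flip: sum_distrib_left)
  with assms show False by blast
qed

section \<open>The modular on a group\<close>

abbreviation modular :: "(real \<Rightarrow> real) \<Rightarrow> 'x set \<Rightarrow> ('x \<Rightarrow> real) \<Rightarrow> real" where
  "modular \<Phi> X f \<equiv> (\<Sum>\<^sub>\<infinity>x\<in>X. \<Phi> (f x))"

lemma infsum_ennreal_finite_iff:
  fixes g :: "'x \<Rightarrow> real"
  assumes nn: "\<And>x. 0 \<le> g x"
  shows "(\<Sum>\<^sub>\<infinity>x\<in>X. ennreal (g x)) < \<infinity> \<longleftrightarrow> g summable_on X"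
proof
  assume fin: "(\<Sum>\<^sub>\<infinity>x\<in>X. ennreal (g x)) < \<infinity>"
  have "sum g A \<le> enn2real (\<Sum>\<^sub>\<infinity>x\<in>X. ennreal (g x))" if "A \<subseteq> X" "finite A" for A
  proof -
    have "ennreal (sum g A) = (\<Sum>\<^sub>\<infinity>x\<in>A. ennreal (g x))" using that nn by (simp add: sum_ennreal)
    also have "\<dots> \<le> (\<Sum>\<^sub>\<infinity>x\<in>X. ennreal (g x))"
      by (rule infsum_mono_neutral) (use that in \<open>auto simp: nonneg_summable_on_complete\<close>)
    finally have "enn2real (ennreal (sum g A)) \<le> enn2real (\<Sum>\<^sub>\<infinity>x\<in>X. ennreal (g x))"
      using fin by (intro enn2real_mono) auto
    then show ?thesis using nn by (simp add: sum_nonneg)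
  qed
  then show "g summable_on X"
    using nn by (intro nonneg_bdd_above_summable_on bdd_aboveI) auto
next
  assume g: "g summable_on X"
  have "(\<Sum>\<^sub>\<infinity>x\<in>X. ennreal (g x)) \<le> ennreal (\<Sum>\<^sub>\<infinity>x\<in>X. g x)"
  proof (rule infsum_le_finite_sums)
    show "(\<Sum>x\<in>A. ennreal (g x)) \<le> ennreal (\<Sum>\<^sub>\<infinity>x\<in>X. g x)" if "finite A" "A \<subseteq> X" for A
      using that nn g by (simp add: sum_ennreal finite_sum_le_infsum ennreal_leI)
  qed (simp add: nonneg_summable_on_complete)
  also have "\<dots> < \<infinity>" by simp
  finally show "(\<Sum>\<^sub>\<infinity>x\<in>X. ennreal (g x)) < \<infinity>" .
qed

text \<open>Summability of \<open>\<Phi> (a * f x)\<close> bounds \<open>f\<close>, and on a bounded range doubling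
  absorbs every change of scale.\<close>

lemma modular_summable_rescale:
  assumes \<Phi>: "N_function \<Phi>" "Delta2_at_0 \<Phi>" and "0 < a" and s: "(\<lambda>x. \<Phi> (a * f x)) summable_on X"
  shows "(\<lambda>x. \<Phi> (c * f x)) summable_on X"
proof -
  note nn = N_function_nonneg [OF \<Phi>(1)]
  define B where "B = modular \<Phi> X (\<lambda>x. a * f x)"
  have B: "\<Phi> (a * f x) \<le> B" if "x \<in> X" for x
    unfolding B_def using finite_sum_le_infsum [OF s, of "{x}"] that nn by simp
  obtain M where M: "0 < M" "B < \<Phi> M" using N_function_unbounded [OF \<Phi>(1)] .
  obtain n where n: "\<bar>c\<bar> / a < 2 ^ n" using real_arch_pow [of 2 "\<bar>c\<bar> / a"] by auto
  obtain K where K: "K \<ge> 1" "\<And>x. \<bar>x\<bar> \<le> M \<Longrightarrow> \<Phi> (2 ^ n * x) \<le> K * \<Phi> x"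
    using Delta2_bounded_doubling_power [OF \<Phi>] by blast
  have "\<Phi> (c * f x) \<le> K * \<Phi> (a * f x)" if "x \<in> X" for x
  proof -
    have "\<bar>c\<bar> \<le> 2 ^ n * a" using n \<open>0 < a\<close> by (simp add: field_simps)
    then have "\<bar>c\<bar> * \<bar>f x\<bar> \<le> 2 ^ n * a * \<bar>f x\<bar>" by (rule mult_right_mono) simp
    then have "\<Phi> (c * f x) \<le> \<Phi> (2 ^ n * (a * f x))"
      using \<open>0 < a\<close> by (intro N_function_mono(2) [OF \<Phi>(1)]) (simp add: abs_mult mult.assoc)
    also have "\<dots> \<le> K * \<Phi> (a * f x)"
      by (rule K(2)) (rule N_function_le_imp_bounded [OF \<Phi>(1) B [OF that] M(2,1)])
    finally show ?thesis .
  qed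
  then show ?thesis
    by (rule summable_on_comparison_test [OF summable_on_cmult_right [OF s]]) (simp_all add: nn)
qed

lemma orlicz_space_iff:
  assumes \<Phi>: "N_function \<Phi>" "Delta2_at_0 \<Phi>"
  shows "f \<in> orlicz_space \<Phi> X \<longleftrightarrow> (\<forall>x. x \<notin> X \<longrightarrow> f x = 0) \<and> (\<lambda>x. \<Phi> (f x)) summable_on X"
proof -
  have "(\<exists>a>0. (\<lambda>x. \<Phi> (a * f x)) summable_on X) \<longleftrightarrow> (\<lambda>x. \<Phi> (f x)) summable_on X"
  proof
    assume "\<exists>a>0. (\<lambda>x. \<Phi> (a * f x)) summable_on X"
    then show "(\<lambda>x. \<Phi> (f x)) summable_on X"
      using modular_summable_rescale [OF \<Phi>, of _ f X 1] unfolding mult_1 by blast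
  next
    assume "(\<lambda>x. \<Phi> (f x)) summable_on X"
    then show "\<exists>a>0. (\<lambda>x. \<Phi> (a * f x)) summable_on X" by (intro exI [of _ 1]) simp
  qed
  then show ?thesis
    unfolding orlicz_space_def orlicz_modular_def
    by (simp add: infsum_ennreal_finite_iff N_function_nonneg \<Phi> del: infinity_ennreal_def)
qed

lemma orlicz_space_summable:
  assumes "N_function \<Phi>" "Delta2_at_0 \<Phi>" "f \<in> orlicz_space \<Phi> X"
  shows "(\<lambda>x. \<Phi> (c * f x)) summable_on X"
proof (rule modular_summable_rescale [OF assms(1,2) zero_less_one])
  show "(\<lambda>x. \<Phi> (1 * f x)) summable_on X" using assms(3) by (simp add: orlicz_space_iff assms(1,2))
qed

lemma orlicz_space_scale:
  assumes "N_function \<Phi>" "Delta2_at_0 \<Phi>" "f \<in> orlicz_space \<Phi> X"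
  shows "(\<lambda>x. c * f x) \<in> orlicz_space \<Phi> X"
  using assms orlicz_space_summable [OF assms] by (simp add: orlicz_space_iff)

lemma orlicz_space_diff:
  assumes "N_function \<Phi>" "f \<in> orlicz_space \<Phi> X" "f' \<in> orlicz_space \<Phi> X"
  shows "f - f' \<in> orlicz_space \<Phi> X"
  using orlicz_space_add [OF assms(1,2) orlicz_space_zero_minus(2) [OF assms(1,3)]] by simp

lemma left_regular_reindex:
  fixes f :: "'g \<Rightarrow> real" and h :: "real \<Rightarrow> real"
  assumes "group G" "g \<in> carrier G"
  shows "(\<lambda>x. h (left_regular G g f x)) summable_on carrier G \<longleftrightarrow> (\<lambda>x. h (f x)) summable_on carrier G"
    and "(\<Sum>\<^sub>\<infinity>x\<in>carrier G. h (left_regular G g f x)) = (\<Sum>\<^sub>\<infinity>x\<in>carrier G. h (f x))"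
proof -
  interpret group G by fact
  have bij: "bij_betw (\<lambda>x. inv\<^bsub>G\<^esub> g \<otimes>\<^bsub>G\<^esub> x) (carrier G) (carrier G)"
    using assms by (intro bij_betw_left_mult) auto
  show "(\<lambda>x. h (left_regular G g f x)) summable_on carrier G \<longleftrightarrow> (\<lambda>x. h (f x)) summable_on carrier G"
    unfolding summable_on_reindex_bij_betw [OF bij, of "\<lambda>x. h (f x)", symmetric]
    by (rule summable_on_cong) (simp add: left_regular_def)
  show "(\<Sum>\<^sub>\<infinity>x\<in>carrier G. h (left_regular G g f x)) = (\<Sum>\<^sub>\<infinity>x\<in>carrier G. h (f x))"
    unfolding infsum_reindex_bij_betw [OF bij, of "\<lambda>x. h (f x)", symmetric]
    by (rule infsum_cong) (simp add: left_regular_def)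
qed

text \<open>The gap for the summable function \<open>\<Phi> \<circ> f\<close> becomes a gap for \<open>f\<close> itself: by
  \<open>N_function_perturbation\<close> its translates differ from it by at most a small multiple of the
  modular of \<open>f\<close>, which the left side absorbs, and a multiple of the modular of
  the differences of \<open>f\<close>.\<close>

lemma l1_gap_imp_modular_gap:
  assumes "group G" and \<Phi>: "N_function \<Phi>" "Delta2_at_0 \<Phi>"
    and F: "finite F" "F \<subseteq> carrier G" and \<epsilon>: "0 < \<epsilon>" "l1_gap G F \<epsilon>"
  obtains C where "0 < C"
    "\<And>f. f \<in> orlicz_space \<Phi> (carrier G) \<Longrightarrow> (\<And>x. \<bar>f x\<bar> \<le> M) \<Longrightarrow>
       modular \<Phi> (carrier G) f \<le> C * (\<Sum>s\<in>F. modular \<Phi> (carrier G) (left_regular G s f - f))"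
proof -
  interpret group G by fact
  note nn = N_function_nonneg [OF \<Phi>(1)]
  define \<delta> where "\<delta> = \<epsilon> / (4 * (real (card F) + 1))"
  have \<delta>: "0 < \<delta>" using \<epsilon> by (simp add: \<delta>_def)
  have \<delta>': "real (card F) * (2 * \<delta>) \<le> \<epsilon> / 2" using \<epsilon> unfolding \<delta>_def by (simp add: divide_simps)
  obtain C where C: "0 < C"
    "\<And>a b. \<bar>a\<bar> \<le> M \<Longrightarrow> \<bar>b\<bar> \<le> M \<Longrightarrow> \<bar>\<Phi> a - \<Phi> b\<bar> \<le> \<delta> * (\<Phi> a + \<Phi> b) + C * \<Phi> (a - b)"
    using N_function_perturbation [OF \<Phi> \<delta>] by blast
  have "modular \<Phi> (carrier G) f \<le> 2 * C / \<epsilon> * (\<Sum>s\<in>F. modular \<Phi> (carrier G) (left_regular G s f - f))"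
    if f: "f \<in> orlicz_space \<Phi> (carrier G)" and M: "\<And>x. \<bar>f x\<bar> \<le> M" for f
  proof -
    let ?\<rho> = "modular \<Phi> (carrier G)"
    define u where "u x = \<Phi> (f x)" for x
    have u: "u summable_on carrier G" unfolding u_def using f orlicz_space_iff [OF \<Phi>] by blast
    have "0 \<le> M" using M [of undefined] by linarith
    have translates: "(\<Sum>\<^sub>\<infinity>x\<in>carrier G. \<bar>left_regular G s u x - u x\<bar>) \<le> 2 * \<delta> * ?\<rho> f + C * ?\<rho> (left_regular G s f - f)"
      if s: "s \<in> F" for s
    proof -
      have sG: "s \<in> carrier G" using s F by auto
      let ?a = "\<lambda>x. \<Phi> (left_regular G s f x)" and ?d = "\<lambda>x. \<Phi> ((left_regular G s f - f) x)"
      have a: "?a summable_on carrier G" "infsum ?a (carrier G) = ?\<rho> f"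
        using left_regular_reindex [OF assms(1) sG, of \<Phi> f] u unfolding u_def by auto
      have "left_regular G s f - f \<in> orlicz_space \<Phi> (carrier G)"
        by (intro orlicz_space_diff left_regular_orlicz_space f assms sG)
      then have d: "?d summable_on carrier G" using \<Phi> by (simp add: orlicz_space_iff)
      have sum: "((\<lambda>x. \<delta> * (?a x + u x) + C * ?d x) has_sum (\<delta> * (?\<rho> f + ?\<rho> f) + C * infsum ?d (carrier G))) (carrier G)"
      proof (intro has_sum_add has_sum_cmult_right)
        show "(?a has_sum ?\<rho> f) (carrier G)" using has_sum_infsum [OF a(1)] a(2) by simp
        show "(u has_sum ?\<rho> f) (carrier G)" using has_sum_infsum [OF u] unfolding u_def .
        show "(?d has_sum infsum ?d (carrier G)) (carrier G)" using d by (rule has_sum_infsum)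
      qed
      have le: "\<bar>left_regular G s u x - u x\<bar> \<le> \<delta> * (?a x + u x) + C * ?d x" if x: "x \<in> carrier G" for x
        using C(2) [of "left_regular G s f x" "f x"] M [of x] M [of "inv\<^bsub>G\<^esub> s \<otimes>\<^bsub>G\<^esub> x"] \<open>0 \<le> M\<close>
        by (simp add: left_regular_def u_def x)
      have "(\<Sum>\<^sub>\<infinity>x\<in>carrier G. \<bar>left_regular G s u x - u x\<bar>) \<le> (\<Sum>\<^sub>\<infinity>x\<in>carrier G. \<delta> * (?a x + u x) + C * ?d x)"
        using summable_on_comparison_test [OF has_sum_imp_summable [OF sum] le] has_sum_imp_summable [OF sum] le
        by (intro infsum_mono) simp_all
      also have "\<dots> = \<delta> * (?\<rho> f + ?\<rho> f) + C * infsum ?d (carrier G)" by (rule infsumI) (rule sum)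
      finally show ?thesis by (simp add: algebra_simps)
    qed
    have \<rho>: "0 \<le> ?\<rho> f" by (rule infsum_nonneg) (rule nn)
    have "\<epsilon> * infsum u (carrier G) \<le> (\<Sum>s\<in>F. \<Sum>\<^sub>\<infinity>x\<in>carrier G. \<bar>left_regular G s u x - u x\<bar>)"
      by (rule \<epsilon>(2) [unfolded l1_gap_def, rule_format, OF _ u]) (simp add: u_def nn)
    then have "\<epsilon> * ?\<rho> f \<le> (\<Sum>s\<in>F. \<Sum>\<^sub>\<infinity>x\<in>carrier G. \<bar>left_regular G s u x - u x\<bar>)"
      by (simp add: u_def cong: infsum_cong)
    also have "\<dots> \<le> (\<Sum>s\<in>F. 2 * \<delta> * ?\<rho> f + C * ?\<rho> (left_regular G s f - f))"
      by (rule sum_mono) (rule translates)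
    also have "\<dots> = real (card F) * (2 * \<delta>) * ?\<rho> f + C * (\<Sum>s\<in>F. ?\<rho> (left_regular G s f - f))"
      by (simp add: sum.distrib sum_distrib_left mult.assoc)
    also have "\<dots> \<le> \<epsilon> / 2 * ?\<rho> f + C * (\<Sum>s\<in>F. ?\<rho> (left_regular G s f - f))"
      using mult_right_mono [OF \<delta>' \<rho>] by simp
    finally have "\<epsilon> / 2 * ?\<rho> f \<le> C * (\<Sum>s\<in>F. ?\<rho> (left_regular G s f - f))" by simp
    then show ?thesis using \<epsilon> by (simp add: field_simps)
  qed
  then show thesis using that [of "2 * C / \<epsilon>"] C \<epsilon> by simp
qed

section \<open>Cocycles on centralizers\<close>

text \<open>Commuting elements give \<open>\<lambda>(s) b(g) - b(g) = \<lambda>(g) b(s) - b(s)\<close>, whose modular is bounded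
  uniformly in \<open>g\<close>, and a gap for the \<open>s\<close> turns this into a bound on \<open>b(g)\<close>. The gap is available
  only for functions with a fixed bound, such as those of modular at most \<open>1\<close>. Hence \<open>b(g)\<close>
  is first divided by the least power of \<open>2\<close> that brings its modular down to at most \<open>1\<close>; by doubling
  that modular is still bounded below, which is impossible for large powers.\<close>

lemma cocycle_bounded_on_commuting_set:
  fixes G :: "('g, 'm) monoid_scheme"
  assumes "group G" and \<Phi>: "N_function \<Phi>" "Delta2_at_0 \<Phi>"
    and F: "finite F" "F \<subseteq> carrier G" and \<epsilon>: "0 < \<epsilon>" "l1_gap G F \<epsilon>"
    and b: "b \<in> Z1 G (orlicz_space \<Phi> (carrier G)) (left_regular G)"
    and S: "S \<subseteq> carrier G" and comm: "\<And>s g. s \<in> F \<Longrightarrow> g \<in> S \<Longrightarrow> s \<otimes>\<^bsub>G\<^esub> g = g \<otimes>\<^bsub>G\<^esub> s"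
  obtains n :: nat where "\<And>g. g \<in> S \<Longrightarrow> modular \<Phi> (carrier G) (\<lambda>x. b g x / 2 ^ n) \<le> 1"
proof -
  interpret group G by fact
  note nn = N_function_nonneg [OF \<Phi>(1)]
  let ?V = "orlicz_space \<Phi> (carrier G)" and ?\<rho> = "modular \<Phi> (carrier G)"
  have bV: "b g \<in> ?V" if "g \<in> carrier G" for g using b that by (auto simp: Z1_def)
  have bmult: "b (g \<otimes>\<^bsub>G\<^esub> h) = b g + left_regular G g (b h)" if "g \<in> carrier G" "h \<in> carrier G" for g h
    using b that by (auto simp: Z1_def)
  have scale: "(\<lambda>x. f x / c) \<in> ?V" if "f \<in> ?V" for f c
    using orlicz_space_scale [OF \<Phi> that, of "1 / c"] by simp
  have summ: "(\<lambda>x. \<Phi> (f x)) summable_on carrier G" if "f \<in> ?V" for f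
    using that \<Phi> by (simp add: orlicz_space_iff)
  obtain M where M: "0 < M" "1 < \<Phi> M" using N_function_unbounded [OF \<Phi>(1)] .
  obtain K where K: "1 \<le> K" "\<And>x. \<bar>x\<bar> \<le> M \<Longrightarrow> \<Phi> (2 * x) \<le> K * \<Phi> x"
    using Delta2_bounded_doubling [OF \<Phi>] by blast
  obtain C where C: "0 < C" "\<And>f. f \<in> ?V \<Longrightarrow> (\<And>x. \<bar>f x\<bar> \<le> M) \<Longrightarrow>
       ?\<rho> f \<le> C * (\<Sum>s\<in>F. ?\<rho> (left_regular G s f - f))"
    by (rule l1_gap_imp_modular_gap [OF \<open>group G\<close> \<Phi> F \<epsilon>, of M]) blast
  define L where "L = (\<Sum>s\<in>F. ?\<rho> (\<lambda>x. 2 * b s x))"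
  have down: "2 ^ j * ?\<rho> (\<lambda>x. f x / 2 ^ j) \<le> ?\<rho> f" if "f \<in> ?V" for f j
  proof -
    have "2 ^ j * ?\<rho> (\<lambda>x. f x / 2 ^ j) = (\<Sum>\<^sub>\<infinity>x\<in>carrier G. 2 ^ j * \<Phi> (f x / 2 ^ j))"
      by (rule infsum_cmult_right' [symmetric])
    also have "\<dots> \<le> ?\<rho> f"
      by (intro infsum_mono summable_on_cmult_right summ scale that N_function_scale_down \<Phi>)
    finally show ?thesis .
  qed
  obtain n where n: "K * C * (2 * L) < 2 ^ n" using real_arch_pow [of 2 "K * C * (2 * L)"] by auto
  have "?\<rho> (\<lambda>x. b g x / 2 ^ n) \<le> 1" if g: "g \<in> S" for g
  proof (rule ccontr)
    assume not: "\<not> ?\<rho> (\<lambda>x. b g x / 2 ^ n) \<le> 1"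
    have gG: "g \<in> carrier G" using g S by auto
    obtain i where i: "?\<rho> (b g) < 2 ^ i" using real_arch_pow [of 2 "?\<rho> (b g)"] by auto
    have "2 ^ i * ?\<rho> (\<lambda>x. b g x / 2 ^ i) < 2 ^ i"
      using down [OF bV [OF gG], of i] i by (rule le_less_trans)
    then have "?\<rho> (\<lambda>x. b g x / 2 ^ i) < 1" by simp
    then have "\<exists>j. ?\<rho> (\<lambda>x. b g x / 2 ^ j) \<le> 1" by (intro exI [of _ i] less_imp_le)
    then obtain j where j: "?\<rho> (\<lambda>x. b g x / 2 ^ j) \<le> 1" "\<And>i. i < j \<Longrightarrow> \<not> ?\<rho> (\<lambda>x. b g x / 2 ^ i) \<le> 1"
      using exists_least_iff [of "\<lambda>j. ?\<rho> (\<lambda>x. b g x / 2 ^ j) \<le> 1"] by blast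
    have nj: "n < j"
    proof (rule ccontr)
      assume "\<not> n < j"
      then have "(2::real) ^ j \<le> 2 ^ n" by (intro power_increasing) auto
      then have "?\<rho> (\<lambda>x. b g x / 2 ^ n) \<le> ?\<rho> (\<lambda>x. b g x / 2 ^ j)"
        by (intro infsum_mono summ scale bV gG N_function_mono(2) [OF \<Phi>(1)])
          (simp add: abs_divide divide_left_mono)
      with j(1) not show False by simp
    qed
    define f where "f x = b g x / 2 ^ j" for x
    have f: "f \<in> ?V" unfolding f_def by (intro scale bV gG)
    have "f x = 0" if "x \<notin> carrier G" for x using f that by (simp add: orlicz_space_def)
    moreover have "\<bar>f x\<bar> \<le> M" if "x \<in> carrier G" for x
    proof (rule N_function_le_imp_bounded [OF \<Phi>(1) _ M(2,1)])
      have "\<Phi> (f x) \<le> ?\<rho> f" using finite_sum_le_infsum [OF summ [OF f], of "{x}"] that nn by simp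
      then show "\<Phi> (f x) \<le> 1" using j(1) by (simp add: f_def)
    qed
    ultimately have fM: "\<bar>f x\<bar> \<le> M" for x using M(1) by (cases "x \<in> carrier G") auto
    have "1 < ?\<rho> (\<lambda>x. 2 * f x)"
    proof -
      obtain i where "j = Suc i" using nj by (cases j) auto
      then show ?thesis using j(2) [of i] by (simp add: f_def)
    qed
    also have "\<dots> \<le> K * ?\<rho> f"
      unfolding infsum_cmult_right' [symmetric]
      by (intro infsum_mono summable_on_cmult_right summ f K fM orlicz_space_summable \<Phi>)
    also have "\<dots> \<le> K * (C * (\<Sum>s\<in>F. ?\<rho> (left_regular G s f - f)))"
      using C(2) [OF f fM] K(1) by (intro mult_left_mono) auto
    also have "\<dots> \<le> K * (C * (\<Sum>s\<in>F. 2 * (?\<rho> (\<lambda>x. 2 * b s x) / 2 ^ j)))"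
    proof (intro mult_left_mono sum_mono)
      fix s assume s: "s \<in> F"
      have sG: "s \<in> carrier G" using s F by auto
      let ?e = "\<lambda>x. \<Phi> (2 * (left_regular G g (b s) x / 2 ^ j))" and ?e' = "\<lambda>x. \<Phi> (2 * (b s x / 2 ^ j))"
      have e': "?e' summable_on carrier G" by (intro orlicz_space_summable \<Phi> scale bV sG)
      have e: "?e summable_on carrier G" "infsum ?e (carrier G) = infsum ?e' (carrier G)"
        using left_regular_reindex [OF assms(1) gG, of "\<lambda>t. \<Phi> (2 * (t / 2 ^ j))" "b s"] e' by auto
      have swap: "b s + left_regular G s (b g) = b g + left_regular G g (b s)"
        using comm [OF s g] bmult [OF sG gG] bmult [OF gG sG] by simp
      have eq: "left_regular G s (b g) x - b g x = left_regular G g (b s) x - b s x" for x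
        using fun_cong [OF swap, of x] by (simp add: algebra_simps)
      have "left_regular G s f x - f x = (left_regular G s (b g) x - b g x) / 2 ^ j" for x
        by (simp add: f_def left_regular_def diff_divide_distrib)
      then have "left_regular G s f x - f x = left_regular G g (b s) x / 2 ^ j - b s x / 2 ^ j" for x
        unfolding eq by (simp only: diff_divide_distrib)
      then have "?\<rho> (left_regular G s f - f) = ?\<rho> (\<lambda>x. left_regular G g (b s) x / 2 ^ j - b s x / 2 ^ j)"
        by simp
      also have "\<dots> \<le> (\<Sum>\<^sub>\<infinity>x\<in>carrier G. ?e x + ?e' x)"
        by (rule infsum_mono [OF summable_on_comparison_test [OF summable_on_add [OF e(1) e']]])
          (intro N_function_diff_le_sum \<Phi> summable_on_add e e' nn)+
      also have "\<dots> = 2 * ?\<rho> (\<lambda>x. 2 * b s x / 2 ^ j)"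
        using infsum_add [OF e(1) e'] e(2) by simp
      also have "\<dots> \<le> 2 * (?\<rho> (\<lambda>x. 2 * b s x) / 2 ^ j)"
        using down [OF orlicz_space_scale [OF \<Phi> bV [OF sG], of 2], of j]
        by (simp add: field_simps)
      finally show "?\<rho> (left_regular G s f - f) \<le> 2 * (?\<rho> (\<lambda>x. 2 * b s x) / 2 ^ j)" .
    qed (use K C in auto)
    also have "\<dots> = K * C * (2 * L) / 2 ^ j"
      by (simp add: L_def sum_distrib_left sum_divide_distrib mult.assoc)
    also have "\<dots> \<le> 1"
    proof -
      have "(2::real) ^ n \<le> 2 ^ j" using nj by (intro power_increasing) auto
      then have "K * C * (2 * L) \<le> 2 ^ j" using n by linarith
      then show ?thesis by simp
    qed
    finally show False by simp
  qed
  then show thesis by (rule that)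
qed

text \<open>Summability leaves only finitely many points with \<open>e \<le> \<bar>w y\<bar>\<close>, and \<open>g \<mapsto> g\<inverse> x\<close> is injective.\<close>

lemma orlicz_translates_tendsto_zero:
  assumes "group G" and \<Phi>: "N_function \<Phi>" "Delta2_at_0 \<Phi>" and w: "w \<in> orlicz_space \<Phi> (carrier G)"
    and S: "S \<subseteq> carrier G" and x: "x \<in> carrier G"
  shows "((\<lambda>g. w (inv\<^bsub>G\<^esub> g \<otimes>\<^bsub>G\<^esub> x)) \<longlongrightarrow> 0) (inf cofinite (principal S))"
proof (rule tendstoI)
  interpret group G by fact
  fix e :: real assume e: "0 < e"
  have s: "(\<lambda>y. \<Phi> (w y)) summable_on carrier G" using w \<Phi> by (simp add: orlicz_space_iff)
  have pos: "0 < \<Phi> e" using e by (intro N_function_pos \<Phi>) auto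
  let ?Y = "{y \<in> carrier G. e \<le> \<bar>w y\<bar>}"
  have fin: "finite ?Y"
  proof (rule ccontr)
    assume inf: "infinite ?Y"
    obtain k :: nat where k: "modular \<Phi> (carrier G) w / \<Phi> e < real k" using reals_Archimedean2 by blast
    obtain A where A: "finite A" "card A = k" "A \<subseteq> ?Y" using infinite_arbitrarily_large [OF inf] by blast
    have "real k * \<Phi> e = (\<Sum>y\<in>A. \<Phi> e)" using A by simp
    also have "\<dots> \<le> (\<Sum>y\<in>A. \<Phi> (w y))"
      using A e by (intro sum_mono N_function_mono(2) [OF \<Phi>(1)]) auto
    also have "\<dots> \<le> modular \<Phi> (carrier G) w"
      using A by (intro finite_sum_le_infsum s N_function_nonneg \<Phi>) auto
    finally show False using k pos by (simp add: field_simps)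
  qed
  let ?T = "{g. \<not> (g \<in> S \<longrightarrow> dist (w (inv\<^bsub>G\<^esub> g \<otimes>\<^bsub>G\<^esub> x)) 0 < e)}"
  have "inj_on (\<lambda>g. inv\<^bsub>G\<^esub> g \<otimes>\<^bsub>G\<^esub> x) ?T"
  proof (rule inj_onI)
    fix g h assume gh: "g \<in> ?T" "h \<in> ?T" "inv\<^bsub>G\<^esub> g \<otimes>\<^bsub>G\<^esub> x = inv\<^bsub>G\<^esub> h \<otimes>\<^bsub>G\<^esub> x"
    then have "g \<in> carrier G" "h \<in> carrier G" using S by auto
    then show "g = h" using gh x by (simp add: inv_inj inj_on_eq_iff [OF inv_inj])
  qed
  moreover have "(\<lambda>g. inv\<^bsub>G\<^esub> g \<otimes>\<^bsub>G\<^esub> x) ` ?T \<subseteq> ?Y" using S x by (auto simp: not_less)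
  ultimately have "finite ?T" using fin by (rule inj_on_finite)
  then show "\<forall>\<^sub>F g in inf cofinite (principal S). dist (w (inv\<^bsub>G\<^esub> g \<otimes>\<^bsub>G\<^esub> x)) 0 < e"
    by (simp add: eventually_inf_principal eventually_cofinite)
qed

lemma cofinite_principal_nontrivial: "infinite S \<Longrightarrow> inf cofinite (principal S) \<noteq> bot"
  by (simp add: trivial_limit_def eventually_inf_principal eventually_cofinite)

lemma orlicz_invariant_imp_zero:
  assumes "group G" and \<Phi>: "N_function \<Phi>" "Delta2_at_0 \<Phi>" and w: "w \<in> orlicz_space \<Phi> (carrier G)"
    and S: "infinite S" "S \<subseteq> carrier G" and inv: "\<And>g. g \<in> S \<Longrightarrow> left_regular G g w = w"
  shows "w = 0"
proof
  fix x
  show "w x = 0 x"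
  proof (cases "x \<in> carrier G")
    case True
    have "w (inv\<^bsub>G\<^esub> g \<otimes>\<^bsub>G\<^esub> x) = w x" if "g \<in> S" for g
      using fun_cong [OF inv [OF that], of x] True by (simp add: left_regular_def)
    then have "\<forall>\<^sub>F g in inf cofinite (principal S). w (inv\<^bsub>G\<^esub> g \<otimes>\<^bsub>G\<^esub> x) = w x"
      by (simp add: eventually_inf_principal)
    then have "((\<lambda>g. w x) \<longlongrightarrow> 0) (inf cofinite (principal S))"
      by (rule Lim_transform_eventually [OF orlicz_translates_tendsto_zero [OF assms(1) \<Phi> w S(2) True]])
    then show ?thesis
      using cofinite_principal_nontrivial [OF S(1)] by (simp add: tendsto_const_iff)
  qed (use w in \<open>simp add: orlicz_space_def\<close>)
qed

text \<open>A pointwise limit \<open>v\<close> of \<open>- b(g)\<close> as \<open>g\<close> leaves finite sets serves as the fixed point: for \<open>h\<close> commuting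
  with \<open>g\<close> the cocycle identity reads \<open>b(h) = b(g) - \<lambda>(h) b(g) + \<lambda>(g) b(h)\<close>, and
  \<open>\<lambda>(g) b(h)\<close> tends to \<open>0\<close> pointwise.\<close>

lemma cocycle_coboundary_on_centralizer:
  fixes G :: "('g, 'm) monoid_scheme"
  assumes "group G" and \<Phi>: "N_function \<Phi>" "Delta2_at_0 \<Phi>"
    and b: "b \<in> Z1 G (orlicz_space \<Phi> (carrier G)) (left_regular G)"
    and S: "infinite S" "S \<subseteq> carrier G"
    and bd: "\<And>g. g \<in> S \<Longrightarrow> modular \<Phi> (carrier G) (\<lambda>x. b g x / 2 ^ n) \<le> 1"
  obtains v where "v \<in> orlicz_space \<Phi> (carrier G)"
    "\<And>h. h \<in> carrier G \<Longrightarrow> (\<And>g. g \<in> S \<Longrightarrow> h \<otimes>\<^bsub>G\<^esub> g = g \<otimes>\<^bsub>G\<^esub> h) \<Longrightarrow> b h = left_regular G h v - v"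
proof -
  interpret group G by fact
  note nn = N_function_nonneg [OF \<Phi>(1)]
  let ?V = "orlicz_space \<Phi> (carrier G)"
  have bV: "b g \<in> ?V" if "g \<in> carrier G" for g using b that by (auto simp: Z1_def)
  have b0: "b g x = 0" if "g \<in> carrier G" "x \<notin> carrier G" for g x
    using bV [OF that(1)] that(2) by (simp add: orlicz_space_def)
  have bmult: "b (g \<otimes>\<^bsub>G\<^esub> h) = b g + left_regular G g (b h)" if "g \<in> carrier G" "h \<in> carrier G" for g h
    using b that by (auto simp: Z1_def)
  have summ: "(\<lambda>x. \<Phi> (b g x / 2 ^ n)) summable_on carrier G" if "g \<in> S" for g
    using orlicz_space_summable [OF \<Phi> bV, of g "1 / 2 ^ n"] that S by auto
  obtain M where M: "0 < M" "1 < \<Phi> M" using N_function_unbounded [OF \<Phi>(1)] .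
  have bound: "\<bar>b g x\<bar> \<le> 2 ^ n * M" if g: "g \<in> S" for g x
  proof (cases "x \<in> carrier G")
    case True
    have "\<Phi> (b g x / 2 ^ n) \<le> 1"
      using finite_sum_le_infsum [OF summ [OF g], of "{x}"] bd [OF g] True nn by simp
    from N_function_le_imp_bounded [OF \<Phi>(1) this M(2,1)] show ?thesis
      by (simp add: abs_divide field_simps)
  qed (use b0 g S M in auto)
  let ?F = "inf cofinite (principal S)"
  have "\<forall>\<^sub>F g in ?F. \<forall>x. \<bar>b g x\<bar> \<le> 2 ^ n * M" using bound by (simp add: eventually_inf_principal)
  then obtain F' l where F': "F' \<le> ?F" "F' \<noteq> bot" and l: "\<And>x. ((\<lambda>g. b g x) \<longlongrightarrow> l x) F'"
    by (rule pointwise_convergent_subfilter [OF cofinite_principal_nontrivial [OF S(1)], of b]) blast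
  have inS: "\<forall>\<^sub>F g in F'. g \<in> S"
    by (rule filter_leD [OF F'(1)]) (simp add: eventually_inf_principal)
  have l0: "l x = 0" if "x \<notin> carrier G" for x
  proof -
    have "\<forall>\<^sub>F g in F'. b g x = 0" using inS by eventually_elim (use b0 S that in auto)
    then have "((\<lambda>g. 0) \<longlongrightarrow> l x) F'" by (rule Lim_transform_eventually [OF l])
    then show ?thesis using F'(2) by (simp add: tendsto_const_iff)
  qed
  \<comment> \<open>Fatou's lemma; the factor \<open>2\<close> makes the pointwise comparison strict, so that it holds
    for \<open>b(g)\<close> once it is close enough to the limit\<close>
  have fatou: "(\<Sum>x\<in>A. \<Phi> (l x / (2 * 2 ^ n))) \<le> 1" if A: "finite A" "A \<subseteq> carrier G" for A
  proof -
    have "\<forall>\<^sub>F g in F'. \<Phi> (l x / (2 * 2 ^ n)) \<le> \<Phi> (b g x / 2 ^ n)" for x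
    proof (cases "l x = 0")
      case False
      have "((\<lambda>g. \<bar>b g x\<bar>) \<longlongrightarrow> \<bar>l x\<bar>) F'" by (rule tendsto_rabs) (rule l)
      then have "\<forall>\<^sub>F g in F'. \<bar>l x\<bar> / 2 < \<bar>b g x\<bar>" by (rule order_tendstoD) (use False in simp)
      then show ?thesis
      proof eventually_elim
        case (elim g)
        then show ?case by (intro N_function_mono(2) [OF \<Phi>(1)]) (simp add: abs_divide abs_mult field_simps)
      qed
    qed (simp add: nn \<Phi>)
    then have "\<forall>\<^sub>F g in F'. \<forall>x\<in>A. \<Phi> (l x / (2 * 2 ^ n)) \<le> \<Phi> (b g x / 2 ^ n)"
      using A by (simp add: eventually_ball_finite)
    then have "\<forall>\<^sub>F g in F'. (\<Sum>x\<in>A. \<Phi> (l x / (2 * 2 ^ n))) \<le> 1" using inS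
    proof eventually_elim
      case (elim g)
      then have "(\<Sum>x\<in>A. \<Phi> (l x / (2 * 2 ^ n))) \<le> (\<Sum>x\<in>A. \<Phi> (b g x / 2 ^ n))" by (intro sum_mono) auto
      also have "\<dots> \<le> modular \<Phi> (carrier G) (\<lambda>x. b g x / 2 ^ n)"
        using A elim by (intro finite_sum_le_infsum summ nn) auto
      also have "\<dots> \<le> 1" using elim by (intro bd)
      finally show ?case .
    qed
    then show ?thesis using F'(2) eventually_happens by blast
  qed
  have "(\<lambda>x. \<Phi> (1 / (2 * 2 ^ n) * l x)) summable_on carrier G"
    using fatou nn by (intro nonneg_bdd_above_summable_on bdd_aboveI [of _ 1]) auto
  from modular_summable_rescale [OF \<Phi> _ this, of 1] have "l \<in> ?V"
    using l0 by (simp add: orlicz_space_iff \<Phi>)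
  then have v: "- l \<in> ?V" by (rule orlicz_space_zero_minus [OF \<Phi>(1)])
  moreover have "b h = left_regular G h (- l) - (- l)"
    if h: "h \<in> carrier G" and comm: "\<And>g. g \<in> S \<Longrightarrow> h \<otimes>\<^bsub>G\<^esub> g = g \<otimes>\<^bsub>G\<^esub> h" for h
  proof
    fix x
    show "b h x = (left_regular G h (- l) - (- l)) x"
    proof (cases "x \<in> carrier G")
      case True
      have "\<forall>\<^sub>F g in F'. b g x + b h (inv\<^bsub>G\<^esub> g \<otimes>\<^bsub>G\<^esub> x) - b g (inv\<^bsub>G\<^esub> h \<otimes>\<^bsub>G\<^esub> x) = b h x"
        using inS
      proof eventually_elim
        case (elim g)
        then have "b h + left_regular G h (b g) = b g + left_regular G g (b h)"
          using comm [of g] bmult [of h g] bmult [of g h] h S by auto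
        from fun_cong [OF this, of x] show ?case using True by (simp add: left_regular_def)
      qed
      moreover have "((\<lambda>g. b h (inv\<^bsub>G\<^esub> g \<otimes>\<^bsub>G\<^esub> x)) \<longlongrightarrow> 0) F'"
        by (rule tendsto_mono [OF F'(1)]) (rule orlicz_translates_tendsto_zero [OF assms(1) \<Phi> bV [OF h] S(2) True])
      then have "((\<lambda>g. b g x + b h (inv\<^bsub>G\<^esub> g \<otimes>\<^bsub>G\<^esub> x) - b g (inv\<^bsub>G\<^esub> h \<otimes>\<^bsub>G\<^esub> x))
          \<longlongrightarrow> l x + 0 - l (inv\<^bsub>G\<^esub> h \<otimes>\<^bsub>G\<^esub> x)) F'"
        by (intro tendsto_intros l)
      ultimately have "((\<lambda>g. b h x) \<longlongrightarrow> l x + 0 - l (inv\<^bsub>G\<^esub> h \<otimes>\<^bsub>G\<^esub> x)) F'"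
        by (rule Lim_transform_eventually [rotated])
      then show ?thesis using F'(2) True by (simp add: tendsto_const_iff left_regular_def)
    qed (use b0 l0 h in \<open>simp add: left_regular_def\<close>)
  qed
  ultimately show thesis using that by blast
qed

section \<open>Coordinate subgroups of a wreath product\<close>

definition wreath_coord :: "('a, 'c) monoid_scheme \<Rightarrow> ('b, 'd) monoid_scheme \<Rightarrow> 'b \<Rightarrow> 'a \<Rightarrow> ('b \<Rightarrow> 'a) \<times> 'b" where
  "wreath_coord G H z k = (\<lambda>i\<in>carrier H. if i = z then k else \<one>\<^bsub>G\<^esub>, \<one>\<^bsub>H\<^esub>)"

lemma wreath_carrier:
  assumes "group G"
  shows "(n, h) \<in> carrier (wreath_product G H) \<longleftrightarrow>
    n \<in> carrier H \<rightarrow>\<^sub>E carrier G \<and> finite {i \<in> carrier H. n i \<noteq> \<one>\<^bsub>G\<^esub>} \<and> h \<in> carrier H"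
  using assms by (auto simp: wreath_product_def semidirect_product_def carrier_sum_group)

lemma wreath_mult:
  "(n, h) \<otimes>\<^bsub>wreath_product G H\<^esub> (n', h') =
    (\<lambda>i\<in>carrier H. n i \<otimes>\<^bsub>G\<^esub> n' (inv\<^bsub>H\<^esub> h \<otimes>\<^bsub>H\<^esub> i), h \<otimes>\<^bsub>H\<^esub> h')"
  by (auto simp: wreath_product_def semidirect_product_def index_shift_def fun_eq_iff)

lemma wreath_coord_mult:
  assumes "group G" "group H" "(n, h) \<in> carrier (wreath_product G H)"
  shows "wreath_coord G H z k \<otimes>\<^bsub>wreath_product G H\<^esub> (n, h) =
    (\<lambda>i\<in>carrier H. (if i = z then k else \<one>\<^bsub>G\<^esub>) \<otimes>\<^bsub>G\<^esub> n i, h)"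
proof -
  interpret G: group G by fact
  interpret H: group H by fact
  show ?thesis
    using assms(3) unfolding wreath_coord_def wreath_mult wreath_carrier [OF assms(1)]
    by (auto simp: fun_eq_iff)
qed

lemma wreath_coord_closed:
  assumes "group G" "group H" "k \<in> carrier G"
  shows "wreath_coord G H z k \<in> carrier (wreath_product G H)"
proof -
  interpret G: group G by fact
  interpret H: group H by fact
  have "finite {i \<in> carrier H. (\<lambda>i\<in>carrier H. if i = z then k else \<one>\<^bsub>G\<^esub>) i \<noteq> \<one>\<^bsub>G\<^esub>}"
    by (rule finite_subset [of _ "{z}"]) auto
  then show ?thesis unfolding wreath_coord_def wreath_carrier [OF assms(1)] using assms(3) by auto
qed

lemma wreath_coord_hom:
  assumes "group G" "group H"
  shows "wreath_coord G H z \<in> hom G (wreath_product G H)"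
proof (rule homI)
  interpret G: group G by fact
  interpret H: group H by fact
  fix k l assume kl: "k \<in> carrier G" "l \<in> carrier G"
  have l: "wreath_coord G H z l = (\<lambda>i\<in>carrier H. if i = z then l else \<one>\<^bsub>G\<^esub>, \<one>\<^bsub>H\<^esub>)"
    by (simp add: wreath_coord_def)
  show "wreath_coord G H z (k \<otimes>\<^bsub>G\<^esub> l) = wreath_coord G H z k \<otimes>\<^bsub>wreath_product G H\<^esub> wreath_coord G H z l"
    unfolding l using wreath_coord_closed [OF assms kl(2), of z]
    by (subst wreath_coord_mult [OF assms]) (auto simp: wreath_coord_def fun_eq_iff kl)
qed (rule wreath_coord_closed [OF assms])

lemma wreath_coord_inj:
  assumes "z \<in> carrier H"
  shows "inj (wreath_coord G H z)"
proof (rule injI)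
  fix k l assume "wreath_coord G H z k = wreath_coord G H z l"
  then have "fst (wreath_coord G H z k) z = fst (wreath_coord G H z l) z" by simp
  then show "k = l" using assms by (simp add: wreath_coord_def)
qed

lemma wreath_coord_commute:
  assumes "group G" "group H" "y \<noteq> z" "k \<in> carrier G" "l \<in> carrier G"
  shows "wreath_coord G H y k \<otimes>\<^bsub>wreath_product G H\<^esub> wreath_coord G H z l
       = wreath_coord G H z l \<otimes>\<^bsub>wreath_product G H\<^esub> wreath_coord G H y k"
proof -
  interpret G: group G by fact
  interpret H: group H by fact
  show ?thesis using assms(3-5) by (auto simp: wreath_coord_def wreath_mult fun_eq_iff)
qed

text \<open>Conjugation by \<open>(n, h)\<close> carries the coordinate subgroup at \<open>\<one>\<close> onto the one at \<open>h\<close>; the twist by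
  \<open>n h\<close> makes the conjugate come out as a prescribed element \<open>k\<close>.\<close>

lemma wreath_coord_conj:
  assumes "group G" "group H" "(n, h) \<in> carrier (wreath_product G H)" "k \<in> carrier G"
  shows "(n, h) \<otimes>\<^bsub>wreath_product G H\<^esub> wreath_coord G H \<one>\<^bsub>H\<^esub> (inv\<^bsub>G\<^esub> n h \<otimes>\<^bsub>G\<^esub> k \<otimes>\<^bsub>G\<^esub> n h)
       = wreath_coord G H h k \<otimes>\<^bsub>wreath_product G H\<^esub> (n, h)"
proof -
  interpret G: group G by fact
  interpret H: group H by fact
  have n: "n i \<in> carrier G" if "i \<in> carrier H" for i
    using assms(3) that by (auto simp: wreath_carrier [OF assms(1)])
  have h: "h \<in> carrier H" using assms(3) by (auto simp: wreath_carrier [OF assms(1)])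
  have "inv\<^bsub>H\<^esub> h \<otimes>\<^bsub>H\<^esub> i = \<one>\<^bsub>H\<^esub> \<longleftrightarrow> i = h" if "i \<in> carrier H" for i
    using h that by (metis H.inv_equality H.inv_inv H.l_inv H.inv_closed)
  moreover have "n h \<otimes>\<^bsub>G\<^esub> (inv\<^bsub>G\<^esub> n h \<otimes>\<^bsub>G\<^esub> k \<otimes>\<^bsub>G\<^esub> n h) = k \<otimes>\<^bsub>G\<^esub> n h"
    using n [OF h] assms(4) by (simp add: G.m_assoc G.inv_solve_left flip: G.m_assoc)
  ultimately show ?thesis
    unfolding wreath_coord_mult [OF assms(1-3)] using h n assms(4)
    by (auto simp: wreath_coord_def wreath_mult fun_eq_iff)
qed

section \<open>Vanishing of the first cohomology\<close>

lemma left_regular_zero [simp]: "left_regular G g 0 = 0"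
  by (simp add: left_regular_def fun_eq_iff)

lemma left_regular_diff: "left_regular G g (f - f') = left_regular G g f - left_regular G g f'"
  by (simp add: left_regular_def fun_eq_iff)

lemma left_regular_mult:
  assumes "group G" "g \<in> carrier G" "h \<in> carrier G"
  shows "left_regular G (g \<otimes>\<^bsub>G\<^esub> h) f = left_regular G g (left_regular G h f)"
proof -
  interpret group G by fact
  show ?thesis using assms(2,3) by (auto simp: left_regular_def fun_eq_iff inv_mult_group m_assoc)
qed

lemma trivial_H1I:
  assumes H1: "group (H1 G V \<pi>)"
    and diff: "\<And>v w. v \<in> V \<Longrightarrow> w \<in> V \<Longrightarrow> v - w \<in> V"
    and \<pi>_diff: "\<And>g v w. g \<in> carrier G \<Longrightarrow> v \<in> V \<Longrightarrow> w \<in> V \<Longrightarrow> \<pi> g (v - w) = \<pi> g v - \<pi> g w"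
    and cob: "\<And>b. b \<in> Z1 G V \<pi> \<Longrightarrow> \<exists>v\<in>V. \<forall>g\<in>carrier G. b g = \<pi> g v - v"
    and G: "group G"
  shows "trivial_group (H1 G V \<pi>)"
proof -
  interpret group G by fact
  have B: "B1 G V \<pi> = Z1 G V \<pi>" using cob by (auto simp: B1_def)
  have minus: "(\<lambda>g\<in>carrier G. b g - c g) \<in> Z1 G V \<pi>" if "b \<in> Z1 G V \<pi>" "c \<in> Z1 G V \<pi>" for b c
    using that unfolding Z1_def by (auto simp: PiE_iff \<pi>_diff diff)
  have plus: "(\<lambda>g\<in>carrier G. b g + c g) \<in> Z1 G V \<pi>" if "b \<in> Z1 G V \<pi>" "c \<in> Z1 G V \<pi>" for b c
  proof -
    let ?n = "\<lambda>g\<in>carrier G. (\<lambda>g\<in>carrier G. c g - c g) g - c g"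
    have "(\<lambda>g\<in>carrier G. b g - ?n g) \<in> Z1 G V \<pi>" by (intro minus that)
    moreover have "(\<lambda>g\<in>carrier G. b g - ?n g) = (\<lambda>g\<in>carrier G. b g + c g)" by auto
    ultimately show ?thesis by simp
  qed
  have "Z1 G V \<pi> #>\<^bsub>Z1_group G V \<pi>\<^esub> a = Z1 G V \<pi>" if a: "a \<in> Z1 G V \<pi>" for a
  proof (intro equalityI subsetI)
    fix c assume c: "c \<in> Z1 G V \<pi>"
    have eq: "c = (\<lambda>g\<in>carrier G. (\<lambda>g\<in>carrier G. c g - a g) g + a g)"
      using c by (auto simp: Z1_def fun_eq_iff PiE_iff extensional_def)
    show "c \<in> Z1 G V \<pi> #>\<^bsub>Z1_group G V \<pi>\<^esub> a"
      unfolding r_coset_def Z1_group_def by (intro UN_I [OF minus [OF c a]]) (use eq in simp)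
  qed (use a plus in \<open>auto simp: r_coset_def Z1_group_def\<close>)
  then have "carrier (H1 G V \<pi>) \<subseteq> {\<one>\<^bsub>H1 G V \<pi>\<^esub>}"
    by (auto simp: H1_def carrier_FactGroup B Z1_group_def)
  then show ?thesis by (simp add: group.trivial_group_subset [OF H1])
qed

text \<open>If \<open>t\<close> and \<open>s = g\<inverse> t g\<close> are both zeros of \<open>b\<close>, then
  \<open>\<lambda>(t) b(g) = b(t g) = b(g s) = b(g)\<close>; no nonzero function in the Orlicz space is fixed by
  infinitely many such \<open>t\<close>.\<close>

lemma cocycle_zero_if_conjugates_zeros:
  assumes "group G" and \<Phi>: "N_function \<Phi>" "Delta2_at_0 \<Phi>"
    and bV: "b g \<in> orlicz_space \<Phi> (carrier G)"
    and bmult: "\<And>g h. g \<in> carrier G \<Longrightarrow> h \<in> carrier G \<Longrightarrow> b (g \<otimes>\<^bsub>G\<^esub> h) = b g + left_regular G g (b h)"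
    and g: "g \<in> carrier G" and T: "infinite T" "T \<subseteq> carrier G" "\<And>t. t \<in> T \<Longrightarrow> b t = 0"
    and conj: "\<And>t. t \<in> T \<Longrightarrow> \<exists>s\<in>carrier G. b s = 0 \<and> g \<otimes>\<^bsub>G\<^esub> s = t \<otimes>\<^bsub>G\<^esub> g"
  shows "b g = 0"
proof (rule orlicz_invariant_imp_zero [OF assms(1) \<Phi> bV T(1,2)])
  fix t assume t: "t \<in> T"
  then obtain s where s: "s \<in> carrier G" "b s = 0" "g \<otimes>\<^bsub>G\<^esub> s = t \<otimes>\<^bsub>G\<^esub> g" using conj by blast
  have "left_regular G t (b g) = b (t \<otimes>\<^bsub>G\<^esub> g)" using bmult [of t g] t T g by (simp add: subset_iff)
  also have "\<dots> = b g" using bmult [OF g s(1)] s by simp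
  finally show "left_regular G t (b g) = b g" .
qed

theorem theorem4p3:
  fixes G1 :: "('a, 'c) monoid_scheme" and G2 :: "('b, 'd) monoid_scheme"
    and G :: "(('b \<Rightarrow> 'a) \<times> 'b) monoid" and \<Phi> :: "real \<Rightarrow> real"
  assumes "group G1" and "countable (carrier G1)" and "carrier G1 \<noteq> {\<one>\<^bsub>G1\<^esub>}"
    and "group G2" and "countable (carrier G2)" and "carrier G2 \<noteq> {\<one>\<^bsub>G2\<^esub>}"
    and "N_function \<Phi>" and "Delta2_at_0 \<Phi>" and "Nabla2_at_0 \<Phi>"
    and "G = wreath_product G1 G2"
    and "\<not> amenable G1"
  shows "trivial_group (H1 G (orlicz_space \<Phi> (carrier G)) (left_regular G))"
proof -
  interpret G1: group G1 by fact
  interpret G2: group G2 by fact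
  have G: "group G" unfolding assms(10) by (rule group_wreath_product) (rule assms)+
  interpret group G by (rule G)
  note \<Phi> = assms(7,8)
  let ?V = "orlicz_space \<Phi> (carrier G)"
  define \<iota> where "\<iota> z k = wreath_coord G1 G2 z k" for z k
  define S where "S z = \<iota> z ` carrier G1" for z
  have inf1: "infinite (carrier G1)" by (rule nonamenable_imp_infinite) (rule assms)+
  have \<iota>_closed: "\<iota> z k \<in> carrier G" if "k \<in> carrier G1" for z k
    unfolding \<iota>_def assms(10) by (rule wreath_coord_closed) (use assms that in auto)
  have S: "S z \<subseteq> carrier G" for z using \<iota>_closed by (auto simp: S_def)
  have S_inf: "infinite (S z)" if "z \<in> carrier G2" for z
    unfolding S_def \<iota>_def using inf1 wreath_coord_inj [OF that, of G1]
    by (metis finite_imageD inj_on_subset subset_UNIV)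
  have comm: "s \<otimes>\<^bsub>G\<^esub> t = t \<otimes>\<^bsub>G\<^esub> s" if "s \<in> S y" "t \<in> S z" "y \<noteq> z" for s t y z
    using that wreath_coord_commute [OF assms(1,4) that(3)] unfolding S_def \<iota>_def assms(10) by auto
  obtain y where y: "y \<in> carrier G2" "y \<noteq> \<one>\<^bsub>G2\<^esub>" using assms(6) G2.one_closed by blast
  \<comment> \<open>the coordinate at \<open>\<one>\<close> is an equivariant map to \<open>G1\<close>\<close>
  obtain F \<epsilon> where F: "finite F" "F \<subseteq> S \<one>\<^bsub>G2\<^esub>" and \<epsilon>: "0 < \<epsilon>" "l1_gap G F \<epsilon>"
  proof (rule nonamenable_l1_gap [OF assms(1) G, of "\<iota> \<one>\<^bsub>G2\<^esub>" "\<lambda>x. fst x \<one>\<^bsub>G2\<^esub>"])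
    show "\<iota> \<one>\<^bsub>G2\<^esub> \<in> hom G1 G" unfolding \<iota>_def assms(10) by (rule wreath_coord_hom) (rule assms)+
  next
    fix x assume "x \<in> carrier G"
    then show "fst x \<one>\<^bsub>G2\<^esub> \<in> carrier G1"
      unfolding assms(10) by (cases x) (auto simp: wreath_carrier assms)
  next
    fix k x assume "k \<in> carrier G1" and x: "x \<in> carrier G"
    then show "fst (\<iota> \<one>\<^bsub>G2\<^esub> k \<otimes>\<^bsub>G\<^esub> x) \<one>\<^bsub>G2\<^esub> = k \<otimes>\<^bsub>G1\<^esub> fst x \<one>\<^bsub>G2\<^esub>"
      unfolding assms(10) \<iota>_def by (cases x) (simp add: wreath_coord_mult assms)
  qed (use assms in \<open>auto simp: S_def\<close>)
  have FG: "F \<subseteq> carrier G" using F S by blast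
  show ?thesis
  proof (rule trivial_H1I [OF group_H1_orlicz [OF G \<Phi>(1)] orlicz_space_diff [OF \<Phi>(1)] left_regular_diff _ G])
    fix b assume b: "b \<in> Z1 G ?V (left_regular G)"
    have bV: "b g \<in> ?V" if "g \<in> carrier G" for g using b that by (auto simp: Z1_def)
    obtain n :: nat where "\<And>g. g \<in> S y \<Longrightarrow> modular \<Phi> (carrier G) (\<lambda>x. b g x / 2 ^ n) \<le> 1"
    proof (rule cocycle_bounded_on_commuting_set [OF G \<Phi> F(1) FG \<epsilon> b S])
      show "s \<otimes>\<^bsub>G\<^esub> g = g \<otimes>\<^bsub>G\<^esub> s" if "s \<in> F" "g \<in> S y" for s g
        using comm [of s "\<one>\<^bsub>G2\<^esub>" g y] that F y by blast
    qed blast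
    then obtain v where v: "v \<in> ?V" and cob: "\<And>h. h \<in> carrier G \<Longrightarrow>
        (\<And>g. g \<in> S y \<Longrightarrow> h \<otimes>\<^bsub>G\<^esub> g = g \<otimes>\<^bsub>G\<^esub> h) \<Longrightarrow> b h = left_regular G h v - v"
      by (rule cocycle_coboundary_on_centralizer [OF G \<Phi> b S_inf [OF y(1)] S]) blast+
    define c where "c g = b g - (left_regular G g v - v)" for g
    have cV: "c g \<in> ?V" if "g \<in> carrier G" for g
      unfolding c_def by (intro orlicz_space_diff \<Phi> bV left_regular_orlicz_space G v that)
    have cmult: "c (g \<otimes>\<^bsub>G\<^esub> h) = c g + left_regular G g (c h)" if "g \<in> carrier G" "h \<in> carrier G" for g h
      using b that by (simp add: c_def Z1_def left_regular_diff left_regular_mult [OF G])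
    note zero = cocycle_zero_if_conjugates_zeros [OF G \<Phi> cV cmult]
    have c_off: "c t = 0" if "t \<in> S z" "z \<noteq> y" for t z
      using cob [of t] comm [OF that(1) _ that(2)] S that(1) by (auto simp: c_def)
    have c_S: "c t = 0" if t: "t \<in> S z" for t z
    proof (cases "z = y")
      case True
      show ?thesis
      proof (rule zero)
        show "infinite (S \<one>\<^bsub>G2\<^esub>)" by (rule S_inf) simp
        show "c s = 0" if "s \<in> S \<one>\<^bsub>G2\<^esub>" for s using c_off [OF that] y by blast
        show "\<exists>s'\<in>carrier G. c s' = 0 \<and> t \<otimes>\<^bsub>G\<^esub> s' = s \<otimes>\<^bsub>G\<^esub> t" if s: "s \<in> S \<one>\<^bsub>G2\<^esub>" for s
          using c_off [OF s] comm [OF t s] True y s S by (intro bexI [of _ s]) auto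
      qed (use t S in auto)
    qed (use c_off t in auto)
    have "c g = 0" if g: "g \<in> carrier G" for g
    proof -
      obtain n h where nh: "g = (n, h)" by (cases g)
      have h: "h \<in> carrier G2" and nh1: "n h \<in> carrier G1"
        using g unfolding nh assms(10) by (auto simp: wreath_carrier assms(1))
      show ?thesis
      proof (rule zero)
        show "infinite (S h)" by (rule S_inf) (rule h)
        fix t assume "t \<in> S h"
        then obtain k where k: "k \<in> carrier G1" "t = \<iota> h k" by (auto simp: S_def)
        let ?k = "inv\<^bsub>G1\<^esub> n h \<otimes>\<^bsub>G1\<^esub> k \<otimes>\<^bsub>G1\<^esub> n h"
        have k': "?k \<in> carrier G1" using k nh1 by simp
        then have "\<iota> \<one>\<^bsub>G2\<^esub> ?k \<in> S \<one>\<^bsub>G2\<^esub>" by (auto simp: S_def)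
        moreover have "g \<otimes>\<^bsub>G\<^esub> \<iota> \<one>\<^bsub>G2\<^esub> ?k = t \<otimes>\<^bsub>G\<^esub> g"
          using wreath_coord_conj [OF assms(1,4) _ k(1), of n h] g
          unfolding nh k(2) \<iota>_def assms(10) by simp
        ultimately show "\<exists>s\<in>carrier G. c s = 0 \<and> g \<otimes>\<^bsub>G\<^esub> s = t \<otimes>\<^bsub>G\<^esub> g"
          using \<iota>_closed [OF k'] c_S by blast
      qed (use g S c_S in auto)
    qed
    then show "\<exists>v\<in>?V. \<forall>g\<in>carrier G. b g = left_regular G g v - v"
      using v by (intro bexI [of _ v]) (auto simp: c_def)
  qed
qed

end
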